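(* For any Banach space $X$ and any free ultrafilter $\mathcal{U}$ on $\mathbb{N}$, $$n(X_{\mathcal{U}})\le n(X).$$
   Context: Banach spaces are over $\mathbb{K}$ ($\mathbb{R}$ or $\mathbb{C}$). For a Banach space $E$, $\mathcal{L}(E)$ denotes the bounded linear operators on $E$, $S_E$ the unit sphere, $E^*$ the dual space. Numerical radius and index: for $T\in\mathcal{L}(E)$, $$v(T)=\sup\{|x^*(Tx)| : x\in S_E,\ x^*\in S_{E^*},\ x^*(x)=1\},$$ and $n(E)=\inf\{v(T): T\in\mathcal{L}(E),\ \|T\|=1\}$. Ultrapower: for a Banach space $X$ and a free (non-principal) ultrafilter $\mathcal{U}$ on $\mathbb{N}$, $X_{\mathcal{U}}=\ell_\infty(X)/\{(x_n)\in\ell_\infty(X):\lim_{\mathcal{U}}\|x_n\|=0\}$, where $\ell_\infty(X)$ is the space of bounded sequences in $X$ (sup norm); the quotient norm of the class $(x_n)_{\mathcal{U}}$ is $\lim_{\mathcal{U}}\|x_n\|$. Here $\lim_{\mathcal{U}}$ denotes the limit of a bounded scalar sequence along $\mathcal{U}$. *)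

theory Defs
  imports "HOL-Analysis.Analysis" "HOL-Algebra.AbelCoset" "HOL-Algebra.Module"
begin

section \<open>Normed spaces on explicit carriers\<close>

text \<open>
  An ultrapower depends on a term, the ultrafilter, so its points do not form a type. Normed spaces
  are therefore records over a carrier set: modules in the sense of HOL-Algebra, extended by a norm,
  over a scalar field that is given by a type. The multiplicative fields that a module record
  inherits from rings are never used.
\<close>

record ('k, 'e) nspace = "('k, 'e) module" +
  nrm :: "'e \<Rightarrow> real"

text \<open>The field \<open>'k\<close>, both as the ring of scalars and as a normed space over itself.\<close>

definition scalars :: "('k::real_normed_field, 'k) nspace" where
  "scalars = \<lparr>carrier = UNIV, mult = (*), one = 1, zero = 0, add = (+), smult = (*), nrm = norm\<rparr>"

lemma cring_scalars: "cring (scalars :: ('k::real_normed_field, 'k) nspace)"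
proof (rule cringI)
  show "abelian_group (scalars :: ('k, 'k) nspace)"
    by (rule abelian_groupI) (simp_all add: scalars_def add.assoc add.commute, metis add.right_inverse)
  show "Group.comm_monoid (scalars :: ('k, 'k) nspace)"
    by (rule comm_monoidI) (simp_all add: scalars_def)
qed (simp add: scalars_def distrib_right)

locale normed_space = module "scalars :: ('k::real_normed_field, 'k) nspace" E
  for E :: "('k::real_normed_field, 'e) nspace" (structure) +
  assumes nrm_eq_zero_iff: "x \<in> carrier E \<Longrightarrow> nrm E x = 0 \<longleftrightarrow> x = \<zero>"
    and nrm_smult: "x \<in> carrier E \<Longrightarrow> nrm E (c \<odot> x) = norm c * nrm E x"
    and nrm_triangle: "x \<in> carrier E \<Longrightarrow> y \<in> carrier E \<Longrightarrow> nrm E (x \<oplus> y) \<le> nrm E x + nrm E y"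

locale banach_space = normed_space E
  for E :: "('k::real_normed_field, 'e) nspace" (structure) +
  assumes complete: "\<lbrakk>\<forall>n. s n \<in> carrier E; \<forall>e>0. \<exists>M. \<forall>m\<ge>M. \<forall>n\<ge>M. nrm E (s m \<ominus> s n) < e\<rbrakk>
    \<Longrightarrow> \<exists>x\<in>carrier E. (\<lambda>n. nrm E (s n \<ominus> x)) \<longlonglongrightarrow> 0"


section \<open>Bounded operators, numerical radius and numerical index\<close>

text \<open>
  Operators are total functions, but only their values on the carrier matter. Two functions that
  agree on the carrier have the same norm and the same numerical radius.
\<close>

definition bounded_ops :: "('k::real_normed_field, 'e) nspace \<Rightarrow> ('k, 'f) nspace \<Rightarrow> ('e \<Rightarrow> 'f) set" where
  "bounded_ops E F = {T \<in> carrier E \<rightarrow> carrier F.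
     (\<forall>x\<in>carrier E. \<forall>y\<in>carrier E. T (x \<oplus>\<^bsub>E\<^esub> y) = T x \<oplus>\<^bsub>F\<^esub> T y) \<and>
     (\<forall>c. \<forall>x\<in>carrier E. T (c \<odot>\<^bsub>E\<^esub> x) = c \<odot>\<^bsub>F\<^esub> T x) \<and>
     (\<exists>B. \<forall>x\<in>carrier E. nrm F (T x) \<le> B * nrm E x)}"

definition op_norm :: "('k::real_normed_field, 'e) nspace \<Rightarrow> ('k, 'f) nspace \<Rightarrow> ('e \<Rightarrow> 'f) \<Rightarrow> real" where
  "op_norm E F T = (SUP x\<in>{x \<in> carrier E. nrm E x \<le> 1}. nrm F (T x))"

abbreviation dual :: "('k::real_normed_field, 'e) nspace \<Rightarrow> ('e \<Rightarrow> 'k) set" where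
  "dual E \<equiv> bounded_ops E scalars"

definition num_radius :: "('k::real_normed_field, 'e) nspace \<Rightarrow> ('e \<Rightarrow> 'e) \<Rightarrow> real" where
  "num_radius E T = Sup {norm (f (T x)) | x f.
     x \<in> carrier E \<and> nrm E x = 1 \<and> f \<in> dual E \<and> op_norm E scalars f = 1 \<and> f x = 1}"

text \<open>
  For \<open>E = {0}\<close> no operator has norm one and the value is \<open>Inf {}\<close>, one fixed
  real number for all zero spaces.
\<close>

definition num_index :: "('k::real_normed_field, 'e) nspace \<Rightarrow> real" where
  "num_index E = Inf {num_radius E T | T. T \<in> bounded_ops E E \<and> op_norm E E T = 1}"


section \<open>Ultrapowers\<close>

definition free_ultrafilter :: "'i filter \<Rightarrow> bool" where
  "free_ultrafilter U \<longleftrightarrow> U \<noteq> bot \<and>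
     (\<forall>P. eventually P U \<or> eventually (\<lambda>i. \<not> P i) U) \<and>
     (\<forall>i. U \<noteq> principal {i})"

definition linf :: "('k::real_normed_field, 'e) nspace \<Rightarrow> ('k, nat \<Rightarrow> 'e) nspace" where
  "linf X = \<lparr>carrier = {x. (\<forall>n. x n \<in> carrier X) \<and> bdd_above (range (\<lambda>n. nrm X (x n)))},
     mult = undefined, one = undefined,
     zero = (\<lambda>n. \<zero>\<^bsub>X\<^esub>), add = (\<lambda>x y n. x n \<oplus>\<^bsub>X\<^esub> y n),
     smult = (\<lambda>c x n. c \<odot>\<^bsub>X\<^esub> x n),
     nrm = (\<lambda>x. SUP n. nrm X (x n))\<rparr>"

definition null_seqs :: "('k::real_normed_field, 'e) nspace \<Rightarrow> nat filter \<Rightarrow> (nat \<Rightarrow> 'e) set" where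
  "null_seqs X U = {x \<in> carrier (linf X). ((\<lambda>n. nrm X (x n)) \<longlongrightarrow> 0) U}"

text \<open>
  Cosets with the quotient norm. The union in the scalar multiplication also gives a full coset
  when the scalar is 0.
\<close>

definition quotient_space :: "('k::real_normed_field, 'e) nspace \<Rightarrow> 'e set \<Rightarrow> ('k, 'e set) nspace" where
  "quotient_space E N = \<lparr>carrier = a_rcosets\<^bsub>E\<^esub> N,
     mult = undefined, one = undefined,
     zero = N, add = set_add E,
     smult = (\<lambda>c C. \<Union>x\<in>C. N +>\<^bsub>E\<^esub> (c \<odot>\<^bsub>E\<^esub> x)),
     nrm = (\<lambda>C. INF x\<in>C. nrm E x)\<rparr>"

definition ultrapower :: "('k::real_normed_field, 'e) nspace \<Rightarrow> nat filter \<Rightarrow> ('k, (nat \<Rightarrow> 'e) set) nspace" where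
  "ultrapower X U = quotient_space (linf X) (null_seqs X U)"

text \<open>
  The remaining lemmas confirm that the quotient is formed as intended: scalars act on
  representatives, and the norm of a class is the limit of the norms along the ultrafilter.
\<close>

context normed_space
begin

lemma smult_zero_l: "x \<in> carrier E \<Longrightarrow> 0 \<odot> x = \<zero>"
  using nrm_smult[of x 0] nrm_eq_zero_iff[of "0 \<odot> x"] smult_closed[of 0 x]
  by (simp add: scalars_def)

lemma smult_in [simp, intro]: "x \<in> carrier E \<Longrightarrow> c \<odot> x \<in> carrier E"
  using smult_closed[of c x] by (simp add: scalars_def)

lemma nrm_nonneg: assumes "x \<in> carrier E" shows "0 \<le> nrm E x"
proof -
  have "(1 + (- 1)) \<odot> x = 1 \<odot> x \<oplus> (- 1) \<odot> x" "1 \<odot> x = x"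
    using smult_l_distr[of 1 "- 1" x] smult_one[of x] assms by (simp_all add: scalars_def)
  then have "nrm E \<zero> \<le> nrm E x + nrm E x"
    using nrm_triangle[of x "(- 1) \<odot> x"] nrm_smult[of x "- 1"] assms by (simp add: smult_zero_l)
  then show ?thesis using nrm_eq_zero_iff[of \<zero>] by simp
qed

lemma minus_eq: assumes "x \<in> carrier E" shows "\<ominus> x = (- 1) \<odot> x"
proof -
  have "((- 1) + 1) \<odot> x = (- 1) \<odot> x \<oplus> 1 \<odot> x" "1 \<odot> x = x"
    using smult_l_distr[of "- 1" 1 x] smult_one[of x] assms by (simp_all add: scalars_def)
  then have "(- 1) \<odot> x \<oplus> x = \<zero>" using assms by (simp add: smult_zero_l)
  then show ?thesis using assms by (simp add: minus_equality)
qed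

lemma nrm_minus: "x \<in> carrier E \<Longrightarrow> nrm E (\<ominus> x) = nrm E x"
  using nrm_smult[of x "- 1"] by (simp add: minus_eq)

lemma linf_simps:
  "zero (linf E) = (\<lambda>n. \<zero>)" "add (linf E) = (\<lambda>x y n. x n \<oplus> y n)"
  "smult (linf E) = (\<lambda>c x n. c \<odot> x n)" "nrm (linf E) = (\<lambda>x. SUP n. nrm E (x n))"
  by (simp_all add: linf_def)

lemma linf_carrier_iff:
  "x \<in> carrier (linf E) \<longleftrightarrow> (\<forall>n. x n \<in> carrier E) \<and> (\<exists>B. \<forall>n. nrm E (x n) \<le> B)"
  by (auto simp: linf_def bdd_above_def)

lemma linf_add: assumes "x \<in> carrier (linf E)" "y \<in> carrier (linf E)"
  shows "(\<lambda>n. x n \<oplus> y n) \<in> carrier (linf E)"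
proof -
  obtain A B where AB: "\<And>n. nrm E (x n) \<le> A" "\<And>n. nrm E (y n) \<le> B"
    using assms by (auto simp: linf_carrier_iff)
  have "nrm E (x n \<oplus> y n) \<le> A + B" for n
    using nrm_triangle[of "x n" "y n"] AB[of n] assms by (simp add: linf_carrier_iff)
  then show ?thesis using assms by (auto simp: linf_carrier_iff)
qed

lemma linf_smult: assumes "x \<in> carrier (linf E)"
  shows "(\<lambda>n. c \<odot> x n) \<in> carrier (linf E)"
proof -
  obtain A where "\<And>n. nrm E (x n) \<le> A"
    using assms by (auto simp: linf_carrier_iff)
  then have "nrm E (c \<odot> x n) \<le> norm c * A" for n
    using nrm_smult[of "x n" c] assms by (simp add: linf_carrier_iff mult_left_mono)
  then show ?thesis using assms by (auto simp: linf_carrier_iff)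
qed

lemma normed_space_linf: "normed_space (linf E)"
proof -
  have grp: "abelian_group (linf E)"
  proof (rule abelian_groupI)
    show "\<exists>y\<in>carrier (linf E). y \<oplus>\<^bsub>linf E\<^esub> x = \<zero>\<^bsub>linf E\<^esub>" if "x \<in> carrier (linf E)" for x
    proof
      show "(\<lambda>n. (- 1) \<odot> x n) \<in> carrier (linf E)" by (rule linf_smult[OF that])
      show "(\<lambda>n. (- 1) \<odot> x n) \<oplus>\<^bsub>linf E\<^esub> x = \<zero>\<^bsub>linf E\<^esub>"
        using that by (auto simp: linf_simps linf_carrier_iff minus_eq[symmetric] l_neg)
    qed
  next
    show "\<zero>\<^bsub>linf E\<^esub> \<in> carrier (linf E)" by (auto simp: linf_simps linf_carrier_iff)
  qed (auto simp: linf_simps linf_add linf_carrier_iff[THEN iffD1] a_assoc intro!: ext a_comm dest: linf_carrier_iff[THEN iffD1])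
  have sup: "nrm E (x n) \<le> nrm (linf E) x" if "x \<in> carrier (linf E)" for x n
    using that by (auto simp: linf_def intro!: cSUP_upper)
  show ?thesis
  proof (intro normed_space.intro moduleI normed_space_axioms.intro cring_scalars grp)
    fix a x assume "x \<in> carrier (linf E)"
    then show "a \<odot>\<^bsub>linf E\<^esub> x \<in> carrier (linf E)" by (simp add: linf_simps linf_smult)
  next
    fix a b :: 'k and x
    assume "x \<in> carrier (linf E)"
    then have x: "x n \<in> carrier E" for n by (simp add: linf_carrier_iff)
    show "(a \<oplus>\<^bsub>scalars\<^esub> b) \<odot>\<^bsub>linf E\<^esub> x = a \<odot>\<^bsub>linf E\<^esub> x \<oplus>\<^bsub>linf E\<^esub> b \<odot>\<^bsub>linf E\<^esub> x"
      using smult_l_distr[OF _ _ x] by (simp add: linf_simps scalars_def)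
    show "(a \<otimes>\<^bsub>scalars\<^esub> b) \<odot>\<^bsub>linf E\<^esub> x = a \<odot>\<^bsub>linf E\<^esub> (b \<odot>\<^bsub>linf E\<^esub> x)"
      using smult_assoc1[OF _ _ x] by (simp add: linf_simps scalars_def)
    show "\<one>\<^bsub>scalars\<^esub> \<odot>\<^bsub>linf E\<^esub> x = x"
      using smult_one[OF x] by (simp add: linf_simps)
  next
    fix a :: 'k and x y
    assume "x \<in> carrier (linf E)" "y \<in> carrier (linf E)"
    then have x: "x n \<in> carrier E" "y n \<in> carrier E" for n by (simp_all add: linf_carrier_iff)
    show "a \<odot>\<^bsub>linf E\<^esub> (x \<oplus>\<^bsub>linf E\<^esub> y) = a \<odot>\<^bsub>linf E\<^esub> x \<oplus>\<^bsub>linf E\<^esub> a \<odot>\<^bsub>linf E\<^esub> y"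
      using smult_r_distr[OF _ x] by (simp add: linf_simps scalars_def)
  next
    fix x assume x: "x \<in> carrier (linf E)"
    then have xc: "x n \<in> carrier E" for n by (simp add: linf_carrier_iff)
    show "(nrm (linf E) x = 0) = (x = \<zero>\<^bsub>linf E\<^esub>)"
    proof
      assume "nrm (linf E) x = 0"
      then have "nrm E (x n) = 0" for n using sup[OF x, of n] nrm_nonneg[OF xc, of n] by simp
      then show "x = \<zero>\<^bsub>linf E\<^esub>" using nrm_eq_zero_iff[OF xc] by (auto simp: linf_simps)
    next
      assume "x = \<zero>\<^bsub>linf E\<^esub>"
      then show "nrm (linf E) x = 0" using nrm_eq_zero_iff[of \<zero>] by (simp add: linf_simps)
    qed
  next
    fix c :: 'k and x assume x: "x \<in> carrier (linf E)"
    then have xc: "x n \<in> carrier E" for n by (simp add: linf_carrier_iff)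
    have "(SUP n. norm c * nrm E (x n)) = norm c * (SUP n. nrm E (x n))"
    proof (cases "c = 0")
      case False
      show ?thesis
      proof (rule antisym)
        show "(SUP n. norm c * nrm E (x n)) \<le> norm c * (SUP n. nrm E (x n))"
          using sup[OF x] by (intro cSUP_least) (auto simp: linf_simps intro: mult_left_mono)
        obtain A where "\<And>n. nrm E (x n) \<le> A" using x by (auto simp: linf_carrier_iff)
        then have bd: "bdd_above (range (\<lambda>n. norm c * nrm E (x n)))"
          by (intro bdd_aboveI2[of _ _ "norm c * A"]) (simp add: mult_left_mono)
        have "(SUP n. nrm E (x n)) \<le> (SUP n. norm c * nrm E (x n)) / norm c"
          using False by (intro cSUP_least) (auto simp: field_simps intro: cSUP_upper[OF _ bd])
        then show "norm c * (SUP n. nrm E (x n)) \<le> (SUP n. norm c * nrm E (x n))"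
          using False by (simp add: field_simps)
      qed
    qed simp
    then show "nrm (linf E) (c \<odot>\<^bsub>linf E\<^esub> x) = norm c * nrm (linf E) x"
      by (simp add: linf_simps nrm_smult[OF xc])
  next
    fix x y assume xy: "x \<in> carrier (linf E)" "y \<in> carrier (linf E)"
    then have xc: "x n \<in> carrier E" "y n \<in> carrier E" for n by (simp_all add: linf_carrier_iff)
    have "nrm E (x n \<oplus> y n) \<le> nrm (linf E) x + nrm (linf E) y" for n
      using nrm_triangle[OF xc, of n n] sup[OF xy(1), of n] sup[OF xy(2), of n] by linarith
    then show "nrm (linf E) (x \<oplus>\<^bsub>linf E\<^esub> y) \<le> nrm (linf E) x + nrm (linf E) y"
      by (auto simp: linf_simps intro: cSUP_least)
  qed
qed

lemma null_seqs_smult: assumes "x \<in> null_seqs E U" shows "c \<odot>\<^bsub>linf E\<^esub> x \<in> null_seqs E U"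
proof -
  have x: "x n \<in> carrier E" for n using assms by (simp add: null_seqs_def linf_carrier_iff)
  have "((\<lambda>n. norm c * nrm E (x n)) \<longlongrightarrow> norm c * 0) U"
    by (rule tendsto_mult_left) (use assms in \<open>simp add: null_seqs_def\<close>)
  then show ?thesis
    using assms by (simp add: null_seqs_def linf_simps linf_smult nrm_smult[OF x])
qed

lemma null_seqs_add: assumes "x \<in> null_seqs E U" "y \<in> null_seqs E U"
  shows "x \<oplus>\<^bsub>linf E\<^esub> y \<in> null_seqs E U"
proof -
  have x: "x n \<in> carrier E" "y n \<in> carrier E" for n
    using assms by (simp_all add: null_seqs_def linf_carrier_iff)
  have "((\<lambda>n. nrm E (x n) + nrm E (y n)) \<longlongrightarrow> 0 + 0) U"
    by (rule tendsto_add) (use assms in \<open>simp_all add: null_seqs_def\<close>)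
  then have s: "((\<lambda>n. nrm E (x n) + nrm E (y n)) \<longlongrightarrow> 0) U" by simp
  have "norm (nrm E (x n \<oplus> y n)) \<le> norm (nrm E (x n) + nrm E (y n)) * 1" for n
    using nrm_nonneg[of "x n \<oplus> y n"] nrm_triangle[of "x n" "y n"] x[of n] by simp
  then have "((\<lambda>n. nrm E (x n \<oplus> y n)) \<longlongrightarrow> 0) U"
    by (intro tendsto_0_le[OF s always_eventually]) blast
  then show ?thesis using assms by (simp add: null_seqs_def linf_simps linf_add)
qed

lemma null_seqs_subgroup: "additive_subgroup (null_seqs E U) (linf E)"
proof -
  interpret L: normed_space "linf E" by (rule normed_space_linf)
  have "nrm E \<zero> = 0" using nrm_eq_zero_iff[of \<zero>] by simp
  then have "\<zero>\<^bsub>linf E\<^esub> \<in> null_seqs E U"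
    using L.zero_closed by (simp add: null_seqs_def linf_simps)
  moreover have "\<ominus>\<^bsub>linf E\<^esub> x \<in> null_seqs E U" if "x \<in> null_seqs E U" for x
    using null_seqs_smult[OF that, of "- 1"] L.minus_eq[of x] that by (simp add: null_seqs_def)
  moreover have "null_seqs E U \<subseteq> carrier (linf E)" by (simp add: null_seqs_def)
  ultimately have "subgroup (null_seqs E U) (add_monoid (linf E))"
    by (intro L.add.subgroupI) (blast intro: null_seqs_add)+
  then show ?thesis by (rule additive_subgroup.intro)
qed

lemma ultrapower_smult:
  assumes "x \<in> carrier (linf E)"
  shows "c \<odot>\<^bsub>ultrapower E U\<^esub> (null_seqs E U +>\<^bsub>linf E\<^esub> x)
       = null_seqs E U +>\<^bsub>linf E\<^esub> (c \<odot>\<^bsub>linf E\<^esub> x)"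
proof -
  interpret L: normed_space "linf E" by (rule normed_space_linf)
  interpret N: additive_subgroup "null_seqs E U" "linf E" by (rule null_seqs_subgroup)
  have eq: "null_seqs E U +>\<^bsub>linf E\<^esub> (c \<odot>\<^bsub>linf E\<^esub> (z \<oplus>\<^bsub>linf E\<^esub> x))
      = null_seqs E U +>\<^bsub>linf E\<^esub> (c \<odot>\<^bsub>linf E\<^esub> x)" if "z \<in> null_seqs E U" for z
  proof -
    have z: "z \<in> carrier (linf E)" using that by simp
    have "c \<odot>\<^bsub>linf E\<^esub> (z \<oplus>\<^bsub>linf E\<^esub> x) = c \<odot>\<^bsub>linf E\<^esub> z \<oplus>\<^bsub>linf E\<^esub> c \<odot>\<^bsub>linf E\<^esub> x"
      using L.smult_r_distr[of c z x] z assms by (simp add: scalars_def)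
    then show ?thesis
      using null_seqs_smult[OF that, of c] z assms L.add.coset_mult_assoc[OF N.a_subset, of "c \<odot>\<^bsub>linf E\<^esub> z" "c \<odot>\<^bsub>linf E\<^esub> x"]
        L.add.coset_join2[OF _ N.a_subgroup, of "c \<odot>\<^bsub>linf E\<^esub> z"]
      by (simp add: a_r_coset_def)
  qed
  have "null_seqs E U \<noteq> {}" using N.zero_closed by blast
  then show ?thesis
    using eq by (auto simp: ultrapower_def quotient_space_def a_r_coset_def'[of "linf E" "null_seqs E U" x])
qed

lemma ultrafilter_limit_exists:
  assumes U: "free_ultrafilter U" and x: "x \<in> carrier (linf E)"
  shows "\<exists>l. ((\<lambda>n. nrm E (x n)) \<longlongrightarrow> l) U"
proof -
  let ?f = "\<lambda>n. nrm E (x n)"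
  obtain B where B: "\<And>n. ?f n \<le> B" using x by (auto simp: linf_carrier_iff)
  have f: "?f n \<in> {0..B}" for n using B[of n] nrm_nonneg[of "x n"] x by (simp add: linf_carrier_iff)
  have ne: "filtermap ?f U \<noteq> bot" using U by (simp add: free_ultrafilter_def filtermap_bot_iff)
  have "eventually (\<lambda>t. t \<in> {0..B}) (filtermap ?f U)" using f by (simp add: eventually_filtermap)
  then obtain l where l: "inf (nhds l) (filtermap ?f U) \<noteq> bot"
    using compact_Icc[of 0 B, unfolded compact_filter, rule_format, OF ne] by blast
  have "eventually (\<lambda>n. ?f n \<in> S) U" if "open S" "l \<in> S" for S
  proof (rule ccontr)
    assume "\<not> ?thesis"
    then have "eventually (\<lambda>n. ?f n \<notin> S) U" using U by (auto simp: free_ultrafilter_def)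
    then have "eventually (\<lambda>t. t \<notin> S) (filtermap ?f U)" by (simp add: eventually_filtermap)
    moreover have "eventually (\<lambda>t. t \<in> S) (nhds l)" using that by (rule eventually_nhds_in_open)
    ultimately have "eventually (\<lambda>t. False) (inf (nhds l) (filtermap ?f U))"
      unfolding eventually_inf by (intro exI[of _ "\<lambda>t. t \<in> S"] exI[of _ "\<lambda>t. t \<notin> S"]) simp
    then show False using l by (simp add: trivial_limit_def)
  qed
  then have "(?f \<longlongrightarrow> l) U" unfolding tendsto_def by simp
  then show ?thesis ..
qed

lemma nrm_ultrapower:
  assumes U: "free_ultrafilter U" and x: "x \<in> carrier (linf E)"
  shows "nrm (ultrapower E U) (null_seqs E U +>\<^bsub>linf E\<^esub> x) = Lim U (\<lambda>n. nrm E (x n))"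
proof -
  have nullD: "z \<in> carrier (linf E)" "((\<lambda>n. nrm E (z n)) \<longlongrightarrow> 0) U"
    if "z \<in> null_seqs E U" for z using that by (simp_all add: null_seqs_def)
  have ne: "null_seqs E U \<noteq> {}"
    using null_seqs_subgroup by (auto dest: additive_subgroup.zero_closed)
  have nt: "U \<noteq> bot" using U by (simp add: free_ultrafilter_def)
  obtain l where l: "((\<lambda>n. nrm E (x n)) \<longlongrightarrow> l) U" using ultrafilter_limit_exists[OF U x] by blast
  have xc: "x n \<in> carrier E" for n using x by (simp add: linf_carrier_iff)
  let ?C = "null_seqs E U +>\<^bsub>linf E\<^esub> x"
  have C: "?C = (\<lambda>z. z \<oplus>\<^bsub>linf E\<^esub> x) ` null_seqs E U" by (auto simp: a_r_coset_def')
  have lower: "l \<le> nrm (linf E) (z \<oplus>\<^bsub>linf E\<^esub> x)" if z: "z \<in> null_seqs E U" for z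
  proof -
    have zc: "z n \<in> carrier E" for n using nullD(1)[OF z] by (simp add: linf_carrier_iff)
    have w: "(\<lambda>n. z n \<oplus> x n) \<in> carrier (linf E)" using nullD(1)[OF z] x by (rule linf_add)
    have "nrm E (x n) - nrm E (z n) \<le> nrm (linf E) (z \<oplus>\<^bsub>linf E\<^esub> x)" for n
    proof -
      have "x n = \<ominus> z n \<oplus> (z n \<oplus> x n)" using xc zc by (simp add: r_neg1)
      then have "nrm E (x n) \<le> nrm E (z n) + nrm E (z n \<oplus> x n)"
        using nrm_triangle[of "\<ominus> z n" "z n \<oplus> x n"] xc zc by (simp add: nrm_minus)
      moreover have "nrm E (z n \<oplus> x n) \<le> (SUP n. nrm E (z n \<oplus> x n))"
        using w by (intro cSUP_upper) (simp_all add: linf_def)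
      ultimately show ?thesis by (simp add: linf_simps)
    qed
    moreover have "((\<lambda>n. nrm E (x n) - nrm E (z n)) \<longlongrightarrow> l - 0) U"
      by (rule tendsto_diff[OF l nullD(2)[OF z]])
    ultimately show ?thesis
      using tendsto_upperbound[OF _ _ nt, of _ "l - 0"] by simp
  qed
  have upper: "\<exists>z\<in>null_seqs E U. nrm (linf E) (z \<oplus>\<^bsub>linf E\<^esub> x) \<le> l + e" if e: "e > 0" for e
  proof -
    define z where "z n = (if nrm E (x n) < l + e then \<zero> else \<ominus> x n)" for n
    have z0: "nrm E \<zero> = 0" using nrm_eq_zero_iff[of \<zero>] by simp
    have "l \<ge> 0" using tendsto_lowerbound[OF l _ nt, of 0] nrm_nonneg[OF xc] by simp
    have "eventually (\<lambda>n. nrm E (x n) < l + e) U" using l e by (auto intro!: order_tendstoD(2))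
    then have "eventually (\<lambda>n. nrm E (z n) = 0) U" by eventually_elim (simp add: z_def z0)
    then have zt: "((\<lambda>n. nrm E (z n)) \<longlongrightarrow> 0) U" by (rule tendsto_eventually)
    obtain B where "\<And>n. nrm E (x n) \<le> B" using x by (auto simp: linf_carrier_iff)
    then have "nrm E (z n) \<le> max B 0" for n by (auto simp: z_def z0 nrm_minus xc le_max_iff_disj)
    moreover have "z n \<in> carrier E" for n using xc by (simp add: z_def)
    ultimately have "z \<in> carrier (linf E)" by (auto simp: linf_carrier_iff)
    then have "z \<in> null_seqs E U" using zt by (simp add: null_seqs_def)
    moreover have "nrm E (z n \<oplus> x n) \<le> l + e" for n
      using e \<open>l \<ge> 0\<close> xc by (auto simp: z_def z0 l_neg)
    then have "nrm (linf E) (z \<oplus>\<^bsub>linf E\<^esub> x) \<le> l + e" by (auto simp: linf_simps intro: cSUP_least)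
    ultimately show ?thesis by blast
  qed
  have "(INF w\<in>?C. nrm (linf E) w) = l"
  proof (rule antisym)
    have bd: "bdd_below (nrm (linf E) ` ?C)" using lower by (auto simp: C intro!: bdd_belowI[of _ l])
    show "(INF w\<in>?C. nrm (linf E) w) \<le> l"
    proof (rule field_le_epsilon)
      fix e :: real assume "e > 0"
      then obtain z where "z \<in> null_seqs E U" "nrm (linf E) (z \<oplus>\<^bsub>linf E\<^esub> x) \<le> l + e"
        using upper by blast
      then show "(INF w\<in>?C. nrm (linf E) w) \<le> l + e"
        by (intro cINF_lower2[OF bd]) (auto simp: C)
    qed
    show "l \<le> (INF w\<in>?C. nrm (linf E) w)"
      using lower ne by (intro cINF_greatest) (auto simp: C)
  qed
  then show ?thesis using tendsto_Lim[OF nt l] by (simp add: ultrapower_def quotient_space_def)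
qed

end

end

theory Submission
  imports Defs
begin

text \<open>
  Every operator \<open>T\<close> of norm one on \<open>X\<close> lifts to the operator \<open>(x\<^sub>n) \<mapsto> (T x\<^sub>n)\<close> of norm one on the
  ultrapower, so it suffices that lifting does not increase the numerical radius \<open>v\<close>. The dual of the
  ultrapower can be larger than the ultrapower of the dual, hence \<open>v\<close> is first expressed by norms.
  Support functionals give \<open>\<parallel>x + c T x\<parallel> \<ge> (1 - \<bar>c\<bar> v) \<parallel>x\<parallel>\<close>, and therefore
  \<open>(1 - \<bar>c\<bar> v) \<parallel>x + c T x\<parallel> \<le> (1 + \<bar>c\<bar>\<^sup>2) \<parallel>x\<parallel>\<close> for all scalars \<open>c\<close>. This estimate passes to limits along
  the ultrafilter, and for \<open>c \<rightarrow> 0\<close> it bounds the numerical radius of the lifted operator by \<open>v\<close>.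
  The support functionals come from the Hahn-Banach theorem.
\<close>

section \<open>Normed spaces and bounded operators\<close>

context normed_space
begin

lemma smult_add_left: "x \<in> carrier E \<Longrightarrow> (a + b) \<odot> x = a \<odot> x \<oplus> b \<odot> x"
  using smult_l_distr[of a b x] by (simp add: scalars_def)

lemma smult_add_right: "x \<in> carrier E \<Longrightarrow> y \<in> carrier E \<Longrightarrow> a \<odot> (x \<oplus> y) = a \<odot> x \<oplus> a \<odot> y"
  using smult_r_distr[of a x y] by (simp add: scalars_def)

lemma smult_smult: "x \<in> carrier E \<Longrightarrow> a \<odot> (b \<odot> x) = (a * b) \<odot> x"
  using smult_assoc1[of a b x] by (simp add: scalars_def)

lemma smult_1 [simp]: "x \<in> carrier E \<Longrightarrow> 1 \<odot> x = x"
  using smult_one[of x] by (simp add: scalars_def)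

lemma nrm_zero [simp]: "nrm E \<zero> = 0"
  using nrm_eq_zero_iff[of \<zero>] by simp

lemma nrm_normalize: "x \<in> carrier E \<Longrightarrow> nrm E x \<noteq> 0 \<Longrightarrow> nrm E (of_real (1 / nrm E x) \<odot> x) = 1"
  using nrm_nonneg[of x] by (simp add: nrm_smult norm_divide)

end

lemma normed_space_scalars: "normed_space (scalars :: ('k::real_normed_field, 'k) nspace)"
proof -
  interpret cring "scalars :: ('k, 'k) nspace" by (rule cring_scalars)
  show ?thesis
  proof (intro normed_space.intro moduleI normed_space_axioms.intro cring_scalars abelian_group_axioms)
  qed (auto simp: scalars_def algebra_simps norm_mult norm_triangle_ineq)
qed

section \<open>Bounded operators and the operator norm\<close>

lemma bounded_opsI:
  assumes "\<And>x. x \<in> carrier E \<Longrightarrow> T x \<in> carrier F"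
    and "\<And>x y. x \<in> carrier E \<Longrightarrow> y \<in> carrier E \<Longrightarrow> T (x \<oplus>\<^bsub>E\<^esub> y) = T x \<oplus>\<^bsub>F\<^esub> T y"
    and "\<And>c x. x \<in> carrier E \<Longrightarrow> T (c \<odot>\<^bsub>E\<^esub> x) = c \<odot>\<^bsub>F\<^esub> T x"
    and "\<And>x. x \<in> carrier E \<Longrightarrow> nrm F (T x) \<le> B * nrm E x"
  shows "T \<in> bounded_ops E F"
  using assms unfolding bounded_ops_def by blast

lemma bounded_opsD:
  assumes "T \<in> bounded_ops E F" "x \<in> carrier E"
  shows bounded_ops_closed: "T x \<in> carrier F"
    and bounded_ops_smult: "T (c \<odot>\<^bsub>E\<^esub> x) = c \<odot>\<^bsub>F\<^esub> T x"
    and bounded_ops_add: "y \<in> carrier E \<Longrightarrow> T (x \<oplus>\<^bsub>E\<^esub> y) = T x \<oplus>\<^bsub>F\<^esub> T y"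
  using assms unfolding bounded_ops_def by blast+

lemma op_norm_least:
  assumes "normed_space E" "\<And>x. x \<in> carrier E \<Longrightarrow> nrm F (T x) \<le> B * nrm E x" "0 \<le> B"
  shows "op_norm E F T \<le> B"
proof -
  interpret normed_space E by fact
  have "nrm F (T x) \<le> B" if "x \<in> carrier E" "nrm E x \<le> 1" for x
    using assms(2)[OF that(1)] mult_left_mono[OF that(2) assms(3)] by simp
  \<comment> \<open>The unit ball contains the zero vector, so the supremum runs over a nonempty set
    even in the zero space.\<close>
  moreover have "\<zero>\<^bsub>E\<^esub> \<in> {x \<in> carrier E. nrm E x \<le> 1}" by simp
  ultimately show ?thesis unfolding op_norm_def by (intro cSUP_least) blast+
qed

lemma op_norm_upper:
  assumes "normed_space E" "T \<in> bounded_ops E F" "x \<in> carrier E" "nrm E x \<le> 1"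
  shows "nrm F (T x) \<le> op_norm E F T"
proof -
  interpret E: normed_space E by fact
  obtain B where B: "\<And>x. x \<in> carrier E \<Longrightarrow> nrm F (T x) \<le> B * nrm E x"
    using assms(2) unfolding bounded_ops_def by blast
  \<comment> \<open>No sign is imposed on the constant \<open>B\<close> in
    \<open>bounded_ops\<close>, hence the absolute value.\<close>
  have "nrm F (T y) \<le> \<bar>B\<bar>" if "y \<in> carrier E" "nrm E y \<le> 1" for y
  proof -
    have "B * nrm E y \<le> \<bar>B\<bar> * nrm E y" using E.nrm_nonneg[OF that(1)] by (simp add: mult_right_mono)
    also have "\<dots> \<le> \<bar>B\<bar>" using that(2) by (simp add: mult_left_le)
    finally show ?thesis using B[OF that(1)] by simp
  qed
  then have "bdd_above ((\<lambda>x. nrm F (T x)) ` {x \<in> carrier E. nrm E x \<le> 1})"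
    by (auto intro!: bdd_aboveI[of _ "\<bar>B\<bar>"])
  then show ?thesis unfolding op_norm_def using assms by (intro cSUP_upper) auto
qed

lemma op_norm_nonneg:
  assumes "normed_space E" "normed_space F" "T \<in> bounded_ops E F"
  shows "0 \<le> op_norm E F T"
proof -
  interpret E: normed_space E by fact
  interpret F: normed_space F by fact
  have "nrm F (T \<zero>\<^bsub>E\<^esub>) \<le> op_norm E F T" using assms by (intro op_norm_upper) auto
  then show ?thesis using F.nrm_nonneg[OF bounded_ops_closed[OF assms(3) E.zero_closed]] by linarith
qed

text \<open>By homogeneity the bound on the unit ball is applied to the normalized vector; a vector
  of norm 0 is zero, and so is its image.\<close>

lemma op_norm_bound:
  assumes "normed_space E" "normed_space F" "T \<in> bounded_ops E F" "x \<in> carrier E"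
  shows "nrm F (T x) \<le> op_norm E F T * nrm E x"
proof -
  interpret E: normed_space E by fact
  interpret F: normed_space F by fact
  show ?thesis
  proof (cases "nrm E x = 0")
    case True
    then have "x = 0 \<odot>\<^bsub>E\<^esub> x" using E.nrm_eq_zero_iff assms(4) E.smult_zero_l by simp
    then have "T x = 0 \<odot>\<^bsub>F\<^esub> T x" using bounded_ops_smult[OF assms(3,4)] by metis
    then have "nrm F (T x) = 0" 
      using bounded_ops_closed[OF assms(3,4)] F.smult_zero_l F.nrm_zero by metis
    then show ?thesis using True by simp
  next
    case False
    define u where "u = of_real (1 / nrm E x) \<odot>\<^bsub>E\<^esub> x"
    have "nrm F (T u) \<le> op_norm E F T"
      using E.nrm_normalize[OF assms(4) False] assms unfolding u_def by (intro op_norm_upper) auto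
    moreover have "nrm F (T u) = nrm F (T x) / nrm E x"
      unfolding u_def using bounded_ops_closed[OF assms(3,4)] bounded_ops_smult[OF assms(3,4)] E.nrm_nonneg[OF assms(4)]
      by (simp add: F.nrm_smult norm_divide)
    ultimately show ?thesis using False E.nrm_nonneg[OF assms(4)] by (simp add: field_simps)
  qed
qed

lemma dualD:
  fixes E :: "('k::real_normed_field, 'e) nspace"
  assumes "f \<in> dual E" "x \<in> carrier E"
  shows dual_add: "y \<in> carrier E \<Longrightarrow> f (x \<oplus>\<^bsub>E\<^esub> y) = f x + f y"
    and dual_smult: "f (c \<odot>\<^bsub>E\<^esub> x) = c * f x"
    and dual_bound: "normed_space E \<Longrightarrow> norm (f x) \<le> op_norm E scalars f * nrm E x"
  using bounded_ops_add[OF assms] bounded_ops_smult[OF assms]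
    op_norm_bound[OF _ normed_space_scalars assms] by (simp_all add: scalars_def)

section \<open>Numerical radius\<close>

text \<open>This is the conclusion of the Hahn-Banach theorem at unit vectors. It is isolated as a
  property so that the numerical radius can be treated over any scalar field, while the real and the
  complex theorem are proved separately.\<close>

definition norming :: "('k::real_normed_field, 'e) nspace \<Rightarrow> bool" where
  "norming E \<longleftrightarrow> (\<forall>x\<in>carrier E. nrm E x = 1 \<longrightarrow>
     (\<exists>f\<in>dual E. op_norm E scalars f = 1 \<and> f x = 1))"

text \<open>The supremum is finite because |g (T y)| \<le> ||T|| for every unit vector y and every
  functional g of norm one.\<close>

lemma num_radius_upper:
  assumes E: "normed_space E" and T: "T \<in> bounded_ops E E"
    and "x \<in> carrier E" "nrm E x = 1" "f \<in> dual E" "op_norm E scalars f = 1" "f x = 1"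
  shows "norm (f (T x)) \<le> num_radius E T"
proof -
  have "norm (g (T y)) \<le> op_norm E E T"
    if "y \<in> carrier E" "nrm E y = 1" "g \<in> dual E" "op_norm E scalars g = 1" for y g
    using dual_bound[OF that(3) bounded_ops_closed[OF T that(1)] E] op_norm_bound[OF E E T that(1)] that
    by simp
  then have "bdd_above {norm (f (T x)) | x f.
     x \<in> carrier E \<and> nrm E x = 1 \<and> f \<in> dual E \<and> op_norm E scalars f = 1 \<and> f x = 1}"
    by (intro bdd_aboveI[of _ "op_norm E E T"]) auto
  then show ?thesis unfolding num_radius_def using assms by (intro cSup_upper) blast+
qed

text \<open>On the zero space every operator norm is 0. Together with a support functional, the unit
  vector makes the set in \<open>num_radius\<close> nonempty.\<close>

lemma exists_unit:
  assumes E: "normed_space E" and T: "op_norm E E T = 1" "T \<in> bounded_ops E E"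
  shows "\<exists>x\<in>carrier E. nrm E x = 1"
proof (rule ccontr)
  interpret normed_space E by fact
  assume no: "\<not> ?thesis"
  have "nrm E x = 0" if "x \<in> carrier E" for x
    using nrm_normalize[OF that] that no by blast
  then have "op_norm E E T \<le> 0"
    by (intro op_norm_least[OF E]) (auto simp: bounded_ops_closed[OF T(2)])
  then show False using T by simp
qed

lemma num_radius_nonneg:
  assumes E: "normed_space E" "norming E" and T: "T \<in> bounded_ops E E" "op_norm E E T = 1"
  shows "0 \<le> num_radius E T"
proof -
  obtain x where x: "x \<in> carrier E" "nrm E x = 1" using exists_unit[OF E(1) T(2,1)] by blast
  then obtain f where f: "f \<in> dual E" "op_norm E scalars f = 1" "f x = 1"
    using E(2) unfolding norming_def by blast
  show ?thesis using num_radius_upper[OF E(1) T(1) x f] norm_ge_zero[of "f (T x)"] by linarith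
qed

text \<open>Write v for the numerical radius. A support functional f at x / ||x|| satisfies f x =
  ||x|| and |f (T x)| \<le> v ||x||, hence ||x + c T x|| \<ge> |f x + c f (T x)| \<ge> ||x|| - |c| v
  ||x||.\<close>

lemma num_radius_lower_estimate:
  fixes c :: "'k::real_normed_field"
  assumes E: "normed_space E" "norming E" and T: "T \<in> bounded_ops E E" and x: "x \<in> carrier E"
  shows "(1 - norm c * num_radius E T) * nrm E x \<le> nrm E (x \<oplus>\<^bsub>E\<^esub> c \<odot>\<^bsub>E\<^esub> T x)"
proof -
  interpret normed_space E by fact
  note Tx = bounded_ops_closed[OF T x]
  show ?thesis
  proof (cases "nrm E x = 0")
    case True
    then show ?thesis using nrm_nonneg x Tx by simp
  next
    case False
    define r where "r = nrm E x"
    have r: "r > 0" using nrm_nonneg[OF x] False by (simp add: r_def)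
    define u where "u = of_real (1 / r) \<odot>\<^bsub>E\<^esub> x"
    have u: "u \<in> carrier E" "nrm E u = 1"
      using nrm_normalize[OF x False] x by (auto simp: u_def r_def)
    obtain f where f: "f \<in> dual E" "op_norm E scalars f = 1" "f u = 1"
      using u E(2) unfolding norming_def by blast
    have fx: "f x = of_real r"
      using f(3) r dual_smult[OF f(1) x] by (simp add: u_def field_simps)
    have "f (T u) = of_real (1 / r) * f (T x)"
      unfolding u_def bounded_ops_smult[OF T x] dual_smult[OF f(1) Tx] ..
    then have "norm (f (T x)) = r * norm (f (T u))" using r by (simp add: norm_mult norm_divide)
    then have fTx: "norm (f (T x)) \<le> r * num_radius E T"
      using num_radius_upper[OF E(1) T u f] r by simp
    have "(1 - norm c * num_radius E T) * r \<le> r - norm c * norm (f (T x))"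
      using mult_left_mono[OF fTx, of "norm c"] by (simp add: algebra_simps)
    also have "\<dots> = norm (of_real r :: 'k) - norm (c * f (T x))" using r by (simp add: norm_mult)
    also have "\<dots> \<le> norm (of_real r + c * f (T x))" by (rule norm_diff_ineq)
    also have "\<dots> = norm (f (x \<oplus>\<^bsub>E\<^esub> c \<odot>\<^bsub>E\<^esub> T x))"
      using dual_add[OF f(1) x smult_in[OF Tx]] dual_smult[OF f(1) Tx] fx by simp
    also have "\<dots> \<le> nrm E (x \<oplus>\<^bsub>E\<^esub> c \<odot>\<^bsub>E\<^esub> T x)"
      using dual_bound[OF f(1) _ E(1), of "x \<oplus>\<^bsub>E\<^esub> c \<odot>\<^bsub>E\<^esub> T x"] x Tx f(2) by simp
    finally show ?thesis by (simp add: r_def)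
  qed
qed

text \<open>The lower estimate is applied to the vector \<open>x + c T x\<close> and the scalar \<open>-c\<close>, using
  \<open>(1 - c T) (1 + c T) = 1 - c\<^sup>2 T\<^sup>2\<close>.\<close>

lemma num_radius_upper_estimate:
  fixes c :: "'k::real_normed_field"
  assumes E: "normed_space E" "norming E" and T: "T \<in> bounded_ops E E" "op_norm E E T = 1"
    and x: "x \<in> carrier E"
  shows "(1 - norm c * num_radius E T) * nrm E (x \<oplus>\<^bsub>E\<^esub> c \<odot>\<^bsub>E\<^esub> T x) \<le> (1 + (norm c)\<^sup>2) * nrm E x"
proof -
  interpret normed_space E by fact
  note Tx = bounded_ops_closed[OF T(1) x]
  note TTx = bounded_ops_closed[OF T(1) Tx]
  let ?y = "x \<oplus>\<^bsub>E\<^esub> c \<odot>\<^bsub>E\<^esub> T x"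
  have y: "?y \<in> carrier E" using x Tx by simp
  have Ty: "T ?y = T x \<oplus>\<^bsub>E\<^esub> c \<odot>\<^bsub>E\<^esub> T (T x)"
    using bounded_ops_add[OF T(1) x] bounded_ops_smult[OF T(1) Tx] Tx by simp
  have "?y \<oplus>\<^bsub>E\<^esub> (- c) \<odot>\<^bsub>E\<^esub> T ?y
      = x \<oplus>\<^bsub>E\<^esub> (c \<odot>\<^bsub>E\<^esub> T x \<oplus>\<^bsub>E\<^esub> (- c) \<odot>\<^bsub>E\<^esub> T x) \<oplus>\<^bsub>E\<^esub> (- (c * c)) \<odot>\<^bsub>E\<^esub> T (T x)"
    unfolding Ty using x Tx TTx by (simp add: smult_add_right smult_smult a_assoc)
  also have "c \<odot>\<^bsub>E\<^esub> T x \<oplus>\<^bsub>E\<^esub> (- c) \<odot>\<^bsub>E\<^esub> T x = \<zero>\<^bsub>E\<^esub>"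
    using smult_add_left[OF Tx, of c "- c"] smult_zero_l[OF Tx] by simp
  finally have "?y \<oplus>\<^bsub>E\<^esub> (- c) \<odot>\<^bsub>E\<^esub> T ?y = x \<oplus>\<^bsub>E\<^esub> (- (c * c)) \<odot>\<^bsub>E\<^esub> T (T x)" using x by simp
  then have "(1 - norm c * num_radius E T) * nrm E ?y \<le> nrm E (x \<oplus>\<^bsub>E\<^esub> (- (c * c)) \<odot>\<^bsub>E\<^esub> T (T x))"
    using num_radius_lower_estimate[OF E T(1) y, of "- c"] by simp
  also have "\<dots> \<le> nrm E x + (norm c)\<^sup>2 * nrm E (T (T x))"
    using nrm_triangle[OF x, of "(- (c * c)) \<odot>\<^bsub>E\<^esub> T (T x)"] TTx
    by (simp add: nrm_smult norm_mult power2_eq_square)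
  also have "\<dots> \<le> nrm E x + (norm c)\<^sup>2 * nrm E x"
    using op_norm_bound[OF E(1) E(1) T(1) x] op_norm_bound[OF E(1) E(1) T(1) Tx] T(2)
    by (intro add_left_mono mult_left_mono) simp_all
  finally show ?thesis by (simp add: algebra_simps)
qed

text \<open>This is the converse of \<open>num_radius_upper_estimate\<close>. For a unit vector x
  with support functional f and w = |f (T x)|, scalars of modulus a turn the estimate into (1 - a v)
  (1 + a w) \<le> 1 + a^2; comparing the terms of first order as a tends to 0 gives w \<le>
  v.\<close>

lemma num_radius_least:
  fixes E :: "('k::real_normed_field, 'e) nspace"
  assumes E: "normed_space E" "norming E" and T: "T \<in> bounded_ops E E" "op_norm E E T = 1"
    and est: "\<And>c x. x \<in> carrier E \<Longrightarrow>
      (1 - norm (c::'k) * v) * nrm E (x \<oplus>\<^bsub>E\<^esub> c \<odot>\<^bsub>E\<^esub> T x) \<le> (1 + (norm c)\<^sup>2) * nrm E x"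
  shows "num_radius E T \<le> v"
proof -
  interpret normed_space E by fact
  have bound: "norm (f (T x)) \<le> v"
    if x: "x \<in> carrier E" "nrm E x = 1" and f: "f \<in> dual E" "op_norm E scalars f = 1" "f x = 1" for x f
  proof -
    define w where "w = norm (f (T x))"
    note Tx = bounded_ops_closed[OF T(1) x(1)]
    have ineq: "(1 - a * v) * (1 + a * w) \<le> 1 + a\<^sup>2" if a: "0 < a" "a * v \<le> 1" for a
    proof -
      \<comment> \<open>The phase of \<open>c\<close> turns f (T x) into its modulus, so that f (x +
        c T x) = 1 + a w. If f (T x) = 0, any scalar of modulus a will do.\<close>
      define c :: 'k where "c = (if f (T x) = 0 then of_real a else of_real (a * w) / f (T x))"
      have c: "norm c = a" using a by (auto simp: c_def norm_divide norm_mult w_def)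
      have cf: "c * f (T x) = of_real (a * w)" by (simp add: c_def w_def)
      have "1 + a * w = norm (of_real (1 + a * w) :: 'k)" using a by (subst norm_of_real) (simp add: w_def)
      also have "\<dots> = norm (f (x \<oplus>\<^bsub>E\<^esub> c \<odot>\<^bsub>E\<^esub> T x))"
        using dual_add[OF f(1) x(1) smult_in[OF Tx]] dual_smult[OF f(1) Tx] f(3) cf by simp
      also have "\<dots> \<le> nrm E (x \<oplus>\<^bsub>E\<^esub> c \<odot>\<^bsub>E\<^esub> T x)"
        using dual_bound[OF f(1) _ E(1), of "x \<oplus>\<^bsub>E\<^esub> c \<odot>\<^bsub>E\<^esub> T x"] x Tx f(2) by simp
      finally have "(1 - a * v) * (1 + a * w) \<le> (1 - a * v) * nrm E (x \<oplus>\<^bsub>E\<^esub> c \<odot>\<^bsub>E\<^esub> T x)"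
        using a by (intro mult_left_mono) auto
      then show ?thesis using est[OF x(1), of c] c x(2) by simp
    qed
    have "((\<lambda>a. a * (1 + v * w)) \<longlongrightarrow> 0 * (1 + v * w)) (at_right 0)"
      by (intro tendsto_intros)
    \<comment> \<open>For small a > 0 the factor 1 - a v is nonnegative, so \<open>ineq\<close>
      applies; it is expanded and divided by a.\<close>
    moreover have "eventually (\<lambda>a. w - v \<le> a * (1 + v * w)) (at_right 0)"
    proof -
      have "((\<lambda>a. a * v) \<longlongrightarrow> 0 * v) (at_right 0)" by (intro tendsto_intros)
      then have "eventually (\<lambda>a. a * v < 1) (at_right 0)" by (rule order_tendstoD) simp
      moreover have "eventually (\<lambda>a::real. 0 < a) (at_right 0)" by (rule eventually_at_right_less)
      ultimately show ?thesis
      proof eventually_elim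
        case (elim a)
        then have "a * (w - v) \<le> a * (a * (1 + v * w))"
          using ineq[of a] by (simp add: algebra_simps power2_eq_square)
        then show ?case using elim by simp
      qed
    qed
    ultimately have "w - v \<le> 0 * (1 + v * w)" by (rule tendsto_lowerbound) simp
    then show ?thesis by (simp add: w_def)
  qed
  \<comment> \<open>Bounding the supremum by v also requires that its set is nonempty.\<close>
  obtain x where x: "x \<in> carrier E" "nrm E x = 1" using exists_unit[OF E(1) T(2,1)] by blast
  then obtain f where "f \<in> dual E" "op_norm E scalars f = 1" "f x = 1"
    using E(2) unfolding norming_def by blast
  then have "{norm (f (T x)) | x f.
     x \<in> carrier E \<and> nrm E x = 1 \<and> f \<in> dual E \<and> op_norm E scalars f = 1 \<and> f x = 1} \<noteq> {}"
    using x by blast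
  then show ?thesis unfolding num_radius_def using bound by (intro cSup_least) blast+
qed

section \<open>Support functionals\<close>

text \<open>Positive homogeneity is stated as an inequality, the form that is easily verified for
  infima; \<open>sublinear_smult\<close> recovers equality.\<close>

definition sublinear :: "(real, 'e) nspace \<Rightarrow> ('e \<Rightarrow> real) \<Rightarrow> bool" where
  "sublinear E p \<longleftrightarrow>
     (\<forall>x\<in>carrier E. \<forall>y\<in>carrier E. p (x \<oplus>\<^bsub>E\<^esub> y) \<le> p x + p y) \<and>
     (\<forall>x\<in>carrier E. \<forall>t\<ge>0. p (t \<odot>\<^bsub>E\<^esub> x) \<le> t * p x)"

text \<open>The infimum is taken over t for fixed s, then over s. This yields subadditivity of
  functionals that are defined as infima.\<close>

lemma le_cINF_add:
  fixes f :: "'a \<Rightarrow> real" and g :: "'b \<Rightarrow> real"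
  assumes "A \<noteq> {}" "B \<noteq> {}" "\<And>s t. s \<in> A \<Longrightarrow> t \<in> B \<Longrightarrow> r \<le> f s + g t"
  shows "r \<le> (INF s\<in>A. f s) + (INF t\<in>B. g t)"
proof -
  have "r - f s \<le> (INF t\<in>B. g t)" if "s \<in> A" for s
    using assms that by (intro cINF_greatest) (auto simp: algebra_simps)
  then have "r - (INF t\<in>B. g t) \<le> (INF s\<in>A. f s)"
    using assms(1) by (intro cINF_greatest) (auto simp: algebra_simps)
  then show ?thesis by simp
qed

lemma le_mult_cINF:
  fixes f :: "'a \<Rightarrow> real"
  assumes "A \<noteq> {}" "t \<ge> 0" "t = 0 \<Longrightarrow> r \<le> 0" "\<And>s. s \<in> A \<Longrightarrow> r \<le> t * f s"
  shows "r \<le> t * (INF s\<in>A. f s)"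
proof (cases "t = 0")
  case False
  then have "r / t \<le> (INF s\<in>A. f s)"
    using assms by (intro cINF_greatest) (auto simp: field_simps)
  then show ?thesis using False assms(2) by (simp add: field_simps)
qed (use assms in simp)

section \<open>Sublinear functionals and the real Hahn-Banach theorem\<close>

locale real_normed_space = normed_space E for E :: "(real, 'e) nspace" (structure)
begin

lemma sublinear_add: "sublinear E p \<Longrightarrow> x \<in> carrier E \<Longrightarrow> y \<in> carrier E \<Longrightarrow> p (x \<oplus> y) \<le> p x + p y"
  unfolding sublinear_def by simp

lemma sublinear_smult_le: "sublinear E p \<Longrightarrow> x \<in> carrier E \<Longrightarrow> 0 \<le> t \<Longrightarrow> p (t \<odot> x) \<le> t * p x"
  unfolding sublinear_def by simp

lemma sublinear_zero: "sublinear E p \<Longrightarrow> p \<zero> = 0"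
  using sublinear_add[of p \<zero> \<zero>] sublinear_smult_le[of p \<zero> 0] smult_zero_l[of \<zero>] by simp

text \<open>The reverse inequality is the given one for the factor 1 / t at the vector t x.\<close>

lemma sublinear_smult:
  assumes p: "sublinear E p" and x: "x \<in> carrier E" and t: "0 \<le> t"
  shows "p (t \<odot> x) = t * p x"
proof (cases "t = 0")
  case True
  then show ?thesis
    using sublinear_zero[OF p] x by (simp add: smult_zero_l)
next
  case False
  have "p ((1 / t) \<odot> (t \<odot> x)) \<le> (1 / t) * p (t \<odot> x)"
    by (rule sublinear_smult_le[OF p]) (use x t in auto)
  then have "t * p x \<le> p (t \<odot> x)" using False t x by (simp add: smult_smult field_simps)
  moreover have "p (t \<odot> x) \<le> t * p x" using p x t by (rule sublinear_smult_le)
  ultimately show ?thesis by simp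
qed

lemma sublinear_ge: "sublinear E p \<Longrightarrow> x \<in> carrier E \<Longrightarrow> y \<in> carrier E \<Longrightarrow> p y - p (\<ominus> x) \<le> p (x \<oplus> y)"
  using sublinear_add[of p "\<ominus> x" "x \<oplus> y"] by (simp add: r_neg1)

text \<open>The largest sublinear functional below \<open>p\<close> whose value at \<open>- y\<close> is at most \<open>- p y\<close>.\<close>

definition tilt :: "('e \<Rightarrow> real) \<Rightarrow> 'e \<Rightarrow> 'e \<Rightarrow> real" where
  "tilt p y x = (INF t\<in>{0..}. p (x \<oplus> t \<odot> y) - t * p y)"

lemma tilt_le:
  assumes p: "sublinear E p" and xy: "x \<in> carrier E" "y \<in> carrier E" and t: "0 \<le> t"
  shows "tilt p y x \<le> p (x \<oplus> t \<odot> y) - t * p y"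
proof -
  \<comment> \<open>A lower bound that is uniform in s makes the infimum in \<open>tilt\<close>
    finite.\<close>
  have "- p (\<ominus> x) \<le> p (x \<oplus> s \<odot> y) - s * p y" if "0 \<le> s" for s
    using sublinear_ge[OF p xy(1) smult_in[OF xy(2)], of s] sublinear_smult[OF p xy(2) that] by simp
  then have "bdd_below ((\<lambda>t. p (x \<oplus> t \<odot> y) - t * p y) ` {0..})" by (auto intro!: bdd_belowI)
  then show ?thesis unfolding tilt_def by (rule cINF_lower) (use t in simp)
qed

lemma tilt_le_self: "sublinear E p \<Longrightarrow> x \<in> carrier E \<Longrightarrow> y \<in> carrier E \<Longrightarrow> tilt p y x \<le> p x"
  using tilt_le[of p x y 0] by (simp add: smult_zero_l)

lemma tilt_minus:
  assumes "sublinear E p" "y \<in> carrier E"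
  shows "tilt p y (\<ominus> y) \<le> - p y"
  using tilt_le[OF assms(1) _ assms(2), of "\<ominus> y" 1] assms by (simp add: l_neg sublinear_zero)

text \<open>Shifts of the two summands by s y and t y add up to a shift of the sum by (s + t) y, and
  scaling by r turns the shift s y into r s y. So every choice of parameters on the right provides
  one on the left.\<close>

lemma sublinear_tilt:
  assumes p: "sublinear E p" and y: "y \<in> carrier E"
  shows "sublinear E (tilt p y)"
  unfolding sublinear_def
proof (intro conjI ballI allI impI)
  fix x x' assume x: "x \<in> carrier E" "x' \<in> carrier E"
  show "tilt p y (x \<oplus> x') \<le> tilt p y x + tilt p y x'"
    unfolding tilt_def[of p y x] tilt_def[of p y x']
  proof (rule le_cINF_add)
    fix s t :: real assume st: "s \<in> {0..}" "t \<in> {0..}"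
    have "tilt p y (x \<oplus> x') \<le> p ((x \<oplus> x') \<oplus> (s + t) \<odot> y) - (s + t) * p y"
      using st x y by (intro tilt_le[OF p]) auto
    also have "(x \<oplus> x') \<oplus> (s + t) \<odot> y = (x \<oplus> s \<odot> y) \<oplus> (x' \<oplus> t \<odot> y)"
      using x y by (simp add: smult_add_left a_ac)
    also have "p \<dots> - (s + t) * p y \<le> p (x \<oplus> s \<odot> y) + p (x' \<oplus> t \<odot> y) - (s + t) * p y"
      using sublinear_add[OF p, of "x \<oplus> s \<odot> y" "x' \<oplus> t \<odot> y"] x y by simp
    finally show "tilt p y (x \<oplus> x') \<le> p (x \<oplus> s \<odot> y) - s * p y + (p (x' \<oplus> t \<odot> y) - t * p y)"
      by (simp add: algebra_simps)
  qed auto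
next
  fix x and r :: real assume x: "x \<in> carrier E" and r: "0 \<le> r"
  show "tilt p y (r \<odot> x) \<le> r * tilt p y x"
    unfolding tilt_def[of p y x]
  proof (rule le_mult_cINF)
    assume "r = 0"
    then show "tilt p y (r \<odot> x) \<le> 0"
      using tilt_le_self[OF p _ y, of \<zero>] x by (simp add: smult_zero_l sublinear_zero[OF p])
  next
    fix s :: real assume s: "s \<in> {0..}"
    have "tilt p y (r \<odot> x) \<le> p (r \<odot> x \<oplus> (r * s) \<odot> y) - (r * s) * p y"
      using r s x y by (intro tilt_le[OF p]) auto
    also have "r \<odot> x \<oplus> (r * s) \<odot> y = r \<odot> (x \<oplus> s \<odot> y)"
      using x y by (simp add: smult_add_right smult_smult)
    also have "p \<dots> = r * p (x \<oplus> s \<odot> y)" using r x y by (intro sublinear_smult[OF p]) auto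
    finally show "tilt p y (r \<odot> x) \<le> r * (p (x \<oplus> s \<odot> y) - s * p y)" by (simp add: algebra_simps)
  qed (use r in auto)
qed

text \<open>Zorn's lemma yields a minimal sublinear functional, and a minimal one agrees with all its tilts.\<close>

lemma hahn_banach:
  assumes q: "sublinear E q"
  shows "\<exists>f. (\<forall>x\<in>carrier E. f x \<le> q x) \<and>
    (\<forall>x\<in>carrier E. \<forall>y\<in>carrier E. f (x \<oplus> y) = f x + f y) \<and>
    (\<forall>c. \<forall>x\<in>carrier E. f (c \<odot> x) = c * f x)"
proof -
  \<comment> \<open>Members vanish outside the carrier, so that the order \<open>P\<close>, a
    comparison at all points of the type, depends only on the carrier; \<open>ext\<close> produces
    such functions.\<close>
  define A where "A = {p. sublinear E p \<and> (\<forall>x\<in>carrier E. p x \<le> q x) \<and> (\<forall>x. x \<notin> carrier E \<longrightarrow> p x = 0)}"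
  define ext where "ext p = (\<lambda>x. if x \<in> carrier E then p x else (0::real))" for p
  have subl_ext: "sublinear E (ext p) \<longleftrightarrow> sublinear E p" for p
    by (simp add: sublinear_def ext_def)
  have ext_A: "ext p \<in> A" if "sublinear E p" "\<And>x. x \<in> carrier E \<Longrightarrow> p x \<le> q x" for p
    using that subl_ext by (auto simp: A_def ext_def)
  \<comment> \<open>The order is reversed: a maximal element, as Zorn's lemma provides it, is a
    minimal functional.\<close>
  define P where "P p p' \<longleftrightarrow> (\<forall>x. p' x \<le> p x)" for p p' :: "'e \<Rightarrow> real"
  have "\<exists>m\<in>A. \<forall>a\<in>A. P m a \<longrightarrow> a = m"
  proof (rule predicate_Zorn)
    show "partial_order_on A (relation_of P A)"
      by (rule partial_order_on_relation_ofI) (auto simp: P_def fun_eq_iff intro: order_trans order_antisym)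
  next
    fix C assume C: "C \<in> Chains (relation_of P A)"
    have CA: "C \<subseteq> A" using C unfolding Chains_def relation_of_def by blast
    have lin: "P p p' \<or> P p' p" if "p \<in> C" "p' \<in> C" for p p'
      using C that unfolding Chains_def relation_of_def by blast
    show "\<exists>u\<in>A. \<forall>a\<in>C. P a u"
    proof (cases "C = {}")
      case True
      then show ?thesis using ext_A[OF q] by blast
    next
      case False
      have sl: "sublinear E p" if "p \<in> C" for p using that CA unfolding A_def by blast
      have le: "p x \<le> q x" if "p \<in> C" "x \<in> carrier E" for p x using that CA unfolding A_def by blast
      \<comment> \<open>In the reversed order the pointwise infimum is an upper bound of the chain.
        It is finite since all members lie above - q (- x).\<close>
      define u where "u x = (INF p\<in>C. p x)" for x
      have "- q (\<ominus> x) \<le> p x" if "p \<in> C" "x \<in> carrier E" for p x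
        using sublinear_ge[OF sl[OF that(1)] that(2), of \<zero>] sublinear_zero[OF sl[OF that(1)]]
          le[OF that(1), of "\<ominus> x"] that(2) by simp
      then have lower: "u x \<le> p x" if "p \<in> C" "x \<in> carrier E" for p x
        unfolding u_def using that by (intro cINF_lower bdd_belowI2) blast+
      have "sublinear E u"
        unfolding sublinear_def
      proof (intro conjI ballI allI impI)
        fix x y assume xy: "x \<in> carrier E" "y \<in> carrier E"
        show "u (x \<oplus> y) \<le> u x + u y"
          unfolding u_def[of x] u_def[of y]
        proof (rule le_cINF_add[OF False False])
          fix p p' assume pp: "p \<in> C" "p' \<in> C"
          \<comment> \<open>One member of the chain must serve both summands; the smaller of p and
            p' does, and two members of a chain are always comparable.\<close>
          have sum: "u (x \<oplus> y) \<le> r x + r y" if "r \<in> C" for r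
            using lower[OF that, of "x \<oplus> y"] sublinear_add[OF sl[OF that] xy] xy by simp
          show "u (x \<oplus> y) \<le> p x + p' y"
            using lin[OF pp]
          proof
            assume "P p p'"
            then have "p' x \<le> p x" by (simp add: P_def)
            then show ?thesis using sum[OF pp(2)] by simp
          next
            assume "P p' p"
            then have "p y \<le> p' y" by (simp add: P_def)
            then show ?thesis using sum[OF pp(1)] by simp
          qed
        qed
      next
        fix x and t :: real assume x: "x \<in> carrier E" and t: "0 \<le> t"
        have le_t: "u (t \<odot> x) \<le> t * p x" if "p \<in> C" for p
          using lower[OF that, of "t \<odot> x"] sublinear_smult[OF sl[OF that] x t] x by simp
        show "u (t \<odot> x) \<le> t * u x"
          unfolding u_def[of x]
        proof (rule le_mult_cINF[OF False t])
          assume "t = 0"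
          moreover obtain p where "p \<in> C" using False by blast
          ultimately show "u (t \<odot> x) \<le> 0" using le_t[of p] by simp
        qed (rule le_t)
      qed
      moreover have "u x \<le> q x" if "x \<in> carrier E" for x
      proof -
        obtain p where "p \<in> C" using False by blast
        then show ?thesis using lower[OF _ that] le[OF _ that] order_trans by blast
      qed
      ultimately have "ext u \<in> A" by (rule ext_A)
      moreover have "P p (ext u)" if "p \<in> C" for p
        using lower[OF that] that CA by (auto simp: P_def ext_def A_def)
      ultimately show ?thesis by blast
    qed
  qed
  then obtain f where fA: "f \<in> A" and min: "\<And>p. p \<in> A \<Longrightarrow> P f p \<Longrightarrow> p = f" by blast
  have f: "sublinear E f" using fA unfolding A_def by blast
  \<comment> \<open>By minimality f equals its tilt at y, hence f (- y) \<le> - f y; the reverse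
    holds by subadditivity. Oddness then makes the sublinear f linear.\<close>
  have odd: "f (\<ominus> y) = - f y" if y: "y \<in> carrier E" for y
  proof -
    have "ext (tilt f y) \<in> A"
      using tilt_le_self[OF f _ y] fA by (intro ext_A sublinear_tilt f y) (force simp: A_def)
    moreover have "P f (ext (tilt f y))"
      using tilt_le_self[OF f _ y] fA by (auto simp: P_def ext_def A_def)
    ultimately have "ext (tilt f y) = f" by (rule min)
    then have "f (\<ominus> y) = ext (tilt f y) (\<ominus> y)" by simp
    then have "f (\<ominus> y) \<le> - f y" using tilt_minus[OF f y] y by (simp add: ext_def)
    moreover have "- f y \<le> f (\<ominus> y)"
      using sublinear_ge[OF f y, of \<zero>] sublinear_ge[OF f, of "\<ominus> y" \<zero>] sublinear_zero[OF f] y by simp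
    ultimately show ?thesis by simp
  qed
  have f_add: "f (x \<oplus> y) = f x + f y" if xy: "x \<in> carrier E" "y \<in> carrier E" for x y
  proof (rule antisym)
    show "f (x \<oplus> y) \<le> f x + f y" using f xy by (rule sublinear_add)
    show "f x + f y \<le> f (x \<oplus> y)" using sublinear_ge[OF f xy] odd[OF xy(1)] by simp
  qed
  have f_smult: "f (c \<odot> x) = c * f x" if x: "x \<in> carrier E" for c x
  proof (cases "0 \<le> c")
    case False
    have "c \<odot> x = \<ominus> ((- c) \<odot> x)" using x by (simp add: minus_eq smult_smult)
    then show ?thesis using odd[OF smult_in[OF x]] sublinear_smult[OF f x, of "- c"] False by simp
  qed (use sublinear_smult[OF f x] in simp)
  have f_le: "f x \<le> q x" if "x \<in> carrier E" for x using fA that by (simp add: A_def)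
  show ?thesis by (rule exI[of _ f]) (simp add: f_add f_smult f_le)
qed

text \<open>Domination by the tilt of the norm at x replaces the extension of a functional from the
  span of x: the tilt lies below the norm, and its value at - x forces f x \<ge> ||x||.\<close>

lemma exists_support_functional:
  assumes x: "x \<in> carrier E"
  shows "\<exists>f. f x = nrm E x \<and> (\<forall>z\<in>carrier E. \<bar>f z\<bar> \<le> nrm E z) \<and>
    (\<forall>y\<in>carrier E. \<forall>z\<in>carrier E. f (y \<oplus> z) = f y + f z) \<and>
    (\<forall>c. \<forall>z\<in>carrier E. f (c \<odot> z) = c * f z)"
proof -
  have N: "sublinear E (nrm E)" by (simp add: sublinear_def nrm_triangle nrm_smult)
  obtain f where f: "\<forall>z\<in>carrier E. f z \<le> tilt (nrm E) x z"
    and add: "\<forall>y\<in>carrier E. \<forall>z\<in>carrier E. f (y \<oplus> z) = f y + f z"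
    and smult: "\<forall>c. \<forall>z\<in>carrier E. f (c \<odot> z) = c * f z"
    using hahn_banach[OF sublinear_tilt[OF N x]] by (elim exE conjE) (rule that)
  have le: "f z \<le> nrm E z" if "z \<in> carrier E" for z
    using bspec[OF f that] tilt_le_self[OF N that x] by simp
  have neg: "f (\<ominus> z) = - f z" if "z \<in> carrier E" for z
    using smult that by (simp add: minus_eq)
  have f_abs: "\<bar>f z\<bar> \<le> nrm E z" if "z \<in> carrier E" for z
    using le[OF that] le[of "\<ominus> z"] neg[OF that] nrm_minus[OF that] that by auto
  have f_x: "f x = nrm E x"
    using bspec[OF f, of "\<ominus> x"] tilt_minus[OF N x] neg[OF x] le[OF x] x by simp
  show ?thesis by (rule exI[of _ f]) (simp add: f_x f_abs add smult)
qed

end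

text \<open>The bound by the norm gives ||f|| \<le> 1, and the value 1 at a unit vector gives ||f||
  \<ge> 1.\<close>

lemma norming_criterion:
  fixes E :: "('k::real_normed_field, 'e) nspace"
  assumes E: "normed_space E"
    and "\<And>x. x \<in> carrier E \<Longrightarrow> nrm E x = 1 \<Longrightarrow> \<exists>f. f x = (1::'k) \<and>
      (\<forall>z\<in>carrier E. norm (f z) \<le> nrm E z) \<and>
      (\<forall>y\<in>carrier E. \<forall>z\<in>carrier E. f (y \<oplus>\<^bsub>E\<^esub> z) = f y + f z) \<and>
      (\<forall>c. \<forall>z\<in>carrier E. f (c \<odot>\<^bsub>E\<^esub> z) = c * f z)"
  shows "norming E"
  unfolding norming_def
proof (intro ballI impI)
  fix x assume x: "x \<in> carrier E" "nrm E x = 1"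
  then obtain f where fx: "f x = 1" and f: "\<And>z. z \<in> carrier E \<Longrightarrow> norm (f z) \<le> nrm E z"
      "\<And>y z. y \<in> carrier E \<Longrightarrow> z \<in> carrier E \<Longrightarrow> f (y \<oplus>\<^bsub>E\<^esub> z) = f y + f z"
      "\<And>c z. z \<in> carrier E \<Longrightarrow> f (c \<odot>\<^bsub>E\<^esub> z) = c * f z"
    using assms(2)[OF x] by (elim exE conjE) blast
  have "f \<in> dual E" by (rule bounded_opsI[where B = 1]) (simp_all add: f scalars_def)
  moreover have "op_norm E scalars f = 1"
  proof (rule antisym)
    show "op_norm E scalars f \<le> 1" by (rule op_norm_least[OF E]) (simp_all add: f scalars_def)
    show "1 \<le> op_norm E scalars f" using dual_bound[OF \<open>f \<in> dual E\<close> x(1) E] x(2) fx by simp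
  qed
  ultimately show "\<exists>f\<in>dual E. op_norm E scalars f = 1 \<and> f x = 1" using fx by blast
qed

lemma norming_real:
  fixes E :: "(real, 'e) nspace"
  assumes "normed_space E"
  shows "norming E"
proof (rule norming_criterion[OF assms])
  interpret real_normed_space E using assms by (rule real_normed_space.intro)
  fix x assume "x \<in> carrier E" "nrm E x = 1"
  then show "\<exists>f. f x = 1 \<and>
      (\<forall>z\<in>carrier E. norm (f z) \<le> nrm E z) \<and>
      (\<forall>y\<in>carrier E. \<forall>z\<in>carrier E. f (y \<oplus>\<^bsub>E\<^esub> z) = f y + f z) \<and>
      (\<forall>c. \<forall>z\<in>carrier E. f (c \<odot>\<^bsub>E\<^esub> z) = c * f z)"
    using exists_support_functional[of x] by simp
qed

section \<open>Support functionals over the complex field\<close>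

definition realify :: "(complex, 'e) nspace \<Rightarrow> (real, 'e) nspace" where
  "realify E = \<lparr>carrier = carrier E, mult = mult E, one = one E, zero = zero E, add = add E,
     smult = (\<lambda>c. smult E (of_real c)), nrm = nrm E\<rparr>"

lemma realify_simps [simp]:
  "carrier (realify E) = carrier E" "zero (realify E) = zero E" "add (realify E) = add E"
  "smult (realify E) c = smult E (of_real c)" "nrm (realify E) = nrm E"
  by (simp_all add: realify_def)

lemma real_normed_space_realify:
  assumes "normed_space E"
  shows "real_normed_space (realify E)"
proof -
  interpret normed_space E by fact
  have "abelian_group (realify E)"
    by (rule abelian_groupI) (auto simp: a_ac intro: l_neg)
  then show ?thesis
    by (intro real_normed_space.intro normed_space.intro moduleI normed_space_axioms.intro cring_scalars)
      (simp_all add: scalars_def smult_add_left smult_add_right smult_smult nrm_eq_zero_iff nrm_smult nrm_triangle)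
qed

text \<open>A support functional g of the underlying real space is the real part of the complex
  functional f z = g z - i g (i z), which is again a support functional.\<close>

lemma norming_complex:
  fixes E :: "(complex, 'e) nspace"
  assumes "normed_space E"
  shows "norming E"
proof (rule norming_criterion[OF assms])
  interpret normed_space E by fact
  interpret R: real_normed_space "realify E" using assms by (rule real_normed_space_realify)
  fix x assume x: "x \<in> carrier E" "nrm E x = 1"
  then obtain g where gx: "g x = 1" and g: "\<And>z. z \<in> carrier E \<Longrightarrow> \<bar>g z\<bar> \<le> nrm E z"
    and add: "\<And>y z. y \<in> carrier E \<Longrightarrow> z \<in> carrier E \<Longrightarrow> g (y \<oplus>\<^bsub>E\<^esub> z) = g y + g z"
    and smult: "\<And>c z. z \<in> carrier E \<Longrightarrow> g (of_real c \<odot>\<^bsub>E\<^esub> z) = c * g z"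
    using R.exists_support_functional[of x] by auto
  define f where "f z = Complex (g z) (- g (\<i> \<odot>\<^bsub>E\<^esub> z))" for z
  have f_add: "f (y \<oplus>\<^bsub>E\<^esub> z) = f y + f z" if "y \<in> carrier E" "z \<in> carrier E" for y z
    using that by (simp add: f_def add smult_add_right complex_eq_iff)
  have f_smult: "f (c \<odot>\<^bsub>E\<^esub> z) = c * f z" if z: "z \<in> carrier E" for c z
  proof -
    have "g (c \<odot>\<^bsub>E\<^esub> w) = Re c * g w + Im c * g (\<i> \<odot>\<^bsub>E\<^esub> w)" if "w \<in> carrier E" for c w
    proof -
      have "c \<odot>\<^bsub>E\<^esub> w = of_real (Re c) \<odot>\<^bsub>E\<^esub> w \<oplus>\<^bsub>E\<^esub> of_real (Im c) \<odot>\<^bsub>E\<^esub> (\<i> \<odot>\<^bsub>E\<^esub> w)"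
        using that smult_add_left[OF that, of "of_real (Re c)" "of_real (Im c) * \<i>"]
        by (simp add: smult_smult complex_eq[of c, symmetric] mult.commute)
      then show ?thesis using that by (simp add: add smult)
    qed
    \<comment> \<open>The instance for c yields the real part of f (c z), the instance for i c its
      imaginary part.\<close>
    from this[OF z, of c] this[OF z, of "\<i> * c"] show ?thesis
      using z by (simp add: f_def complex_eq_iff smult_smult)
  qed
  have f_norm: "norm (f z) \<le> nrm E z" if z: "z \<in> carrier E" for z
  proof (cases "f z = 0")
    case True
    then show ?thesis using nrm_nonneg[OF z] by simp
  next
    case False
    \<comment> \<open>Multiplying z by this scalar of modulus 1 makes f real and nonnegative there,
      so its value is that of g, which the norm bounds.\<close>
    define c where "c = of_real (norm (f z)) / f z"
    have c: "norm c = 1" using False by (simp add: c_def norm_divide)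
    have "f (c \<odot>\<^bsub>E\<^esub> z) = of_real (norm (f z))" using f_smult[OF z] False by (simp add: c_def)
    then have "norm (f z) = g (c \<odot>\<^bsub>E\<^esub> z)" by (simp add: f_def complex_eq_iff)
    also have "\<dots> \<le> nrm E (c \<odot>\<^bsub>E\<^esub> z)" using g[OF smult_in[OF z], of c] by simp
    also have "\<dots> = nrm E z" using c z by (simp add: nrm_smult)
    finally show ?thesis .
  qed
  have "f x = 1"
  proof -
    \<comment> \<open>The real part of f x is already 1, so |f x| \<le> 1 leaves no room for an
      imaginary part.\<close>
    have "(norm (f x))\<^sup>2 = 1 + (g (\<i> \<odot>\<^bsub>E\<^esub> x))\<^sup>2" using gx by (simp add: f_def cmod_def)
    moreover have "(norm (f x))\<^sup>2 \<le> 1" using f_norm[OF x(1)] x(2) by (simp add: power_le_one)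
    ultimately show ?thesis using gx by (simp add: f_def complex_eq_iff)
  qed
  then show "\<exists>f. f x = 1 \<and>
      (\<forall>z\<in>carrier E. norm (f z) \<le> nrm E z) \<and>
      (\<forall>y\<in>carrier E. \<forall>z\<in>carrier E. f (y \<oplus>\<^bsub>E\<^esub> z) = f y + f z) \<and>
      (\<forall>c. \<forall>z\<in>carrier E. f (c \<odot>\<^bsub>E\<^esub> z) = c * f z)"
    using f_add f_smult f_norm by blast
qed

section \<open>Ultrapowers\<close>

context normed_space
begin

context
  fixes U :: "nat filter"
begin

abbreviation ucls :: "(nat \<Rightarrow> 'e) \<Rightarrow> (nat \<Rightarrow> 'e) set" where
  "ucls x \<equiv> null_seqs E U +>\<^bsub>linf E\<^esub> x"

section \<open>The ultrapower as a normed space\<close>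

lemma null_seqs_abelian_subgroup: "abelian_subgroup (null_seqs E U) (linf E)"
proof -
  interpret L: normed_space "linf E" by (rule normed_space_linf)
  show ?thesis by (rule abelian_subgroupI3[OF null_seqs_subgroup L.abelian_group_axioms])
qed

lemma carrier_ultrapower: "carrier (ultrapower E U) = ucls ` carrier (linf E)"
  by (auto simp: ultrapower_def quotient_space_def A_RCOSETS_def')

lemma ultrapower_add:
  assumes "x \<in> carrier (linf E)" "y \<in> carrier (linf E)"
  shows "ucls x \<oplus>\<^bsub>ultrapower E U\<^esub> ucls y = ucls (\<lambda>n. x n \<oplus> y n)"
  using abelian_subgroup.a_rcos_sum[OF null_seqs_abelian_subgroup assms]
  by (simp add: ultrapower_def quotient_space_def linf_simps)

lemma ultrapower_smult':
  assumes "x \<in> carrier (linf E)"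
  shows "c \<odot>\<^bsub>ultrapower E U\<^esub> ucls x = ucls (\<lambda>n. c \<odot> x n)"
  using ultrapower_smult[OF assms] by (simp add: linf_simps)

lemma ultrapower_zero: "\<zero>\<^bsub>ultrapower E U\<^esub> = null_seqs E U"
  by (simp add: ultrapower_def quotient_space_def)

lemma ucls_eq_null_seqs_iff:
  assumes "x \<in> carrier (linf E)"
  shows "ucls x = null_seqs E U \<longleftrightarrow> x \<in> null_seqs E U"
proof -
  interpret S: abelian_subgroup "null_seqs E U" "linf E" by (rule null_seqs_abelian_subgroup)
  show ?thesis using S.a_rcos_self[OF assms] S.a_rcos_const by auto
qed

lemma abelian_group_ultrapower: "abelian_group (ultrapower E U)"
proof -
  interpret L: normed_space "linf E" by (rule normed_space_linf)
  have zero: "\<zero>\<^bsub>ultrapower E U\<^esub> = ucls (\<lambda>n. \<zero>)" and zero_in: "(\<lambda>n. \<zero>) \<in> carrier (linf E)"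
    using ucls_eq_null_seqs_iff[OF L.zero_closed] additive_subgroup.zero_closed[OF null_seqs_subgroup]
      L.zero_closed by (simp_all add: ultrapower_zero linf_simps)
  have pointwise: "x n \<in> carrier E" if "x \<in> carrier (linf E)" for x n
    using that by (simp add: linf_carrier_iff)
  show ?thesis
  proof (rule abelian_groupI)
    fix C assume "C \<in> carrier (ultrapower E U)"
    then obtain x where x: "x \<in> carrier (linf E)" "C = ucls x" by (auto simp: carrier_ultrapower)
    have "(- 1) \<odot> x n \<oplus> x n = \<zero>" for n
      using pointwise[OF x(1), of n] by (simp add: minus_eq[symmetric] l_neg)
    then have "ucls (\<lambda>n. (- 1) \<odot> x n) \<oplus>\<^bsub>ultrapower E U\<^esub> C = \<zero>\<^bsub>ultrapower E U\<^esub>"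
      using x by (simp add: ultrapower_add linf_smult zero)
    then show "\<exists>D\<in>carrier (ultrapower E U). D \<oplus>\<^bsub>ultrapower E U\<^esub> C = \<zero>\<^bsub>ultrapower E U\<^esub>"
      using linf_smult[OF x(1)] unfolding carrier_ultrapower by blast
  qed (auto simp: carrier_ultrapower ultrapower_add linf_add zero zero_in pointwise a_ac)
qed

lemma nrm_ultrapower_tendsto:
  assumes "free_ultrafilter U" "x \<in> carrier (linf E)"
  shows "((\<lambda>n. nrm E (x n)) \<longlongrightarrow> nrm (ultrapower E U) (ucls x)) U"
proof -
  obtain l where l: "((\<lambda>n. nrm E (x n)) \<longlongrightarrow> l) U" using ultrafilter_limit_exists[OF assms] by blast
  have "U \<noteq> bot" using assms(1) by (simp add: free_ultrafilter_def)
  then show ?thesis using nrm_ultrapower[OF assms] tendsto_Lim[OF _ l] l by simp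
qed

text \<open>Limits along \<open>U\<close> preserve inequalities. The factors may have any sign,
  which matters because 1 - |c| v can be negative.\<close>

lemma nrm_ultrapower_le:
  assumes U: "free_ultrafilter U" and x: "x \<in> carrier (linf E)" and y: "y \<in> carrier (linf E)"
    and le: "\<And>n. a * nrm E (x n) \<le> b * nrm E (y n)"
  shows "a * nrm (ultrapower E U) (ucls x) \<le> b * nrm (ultrapower E U) (ucls y)"
proof (rule tendsto_le)
  show "((\<lambda>n. b * nrm E (y n)) \<longlongrightarrow> b * nrm (ultrapower E U) (ucls y)) U"
    by (intro tendsto_intros nrm_ultrapower_tendsto[OF U y])
  show "((\<lambda>n. a * nrm E (x n)) \<longlongrightarrow> a * nrm (ultrapower E U) (ucls x)) U"
    by (intro tendsto_intros nrm_ultrapower_tendsto[OF U x])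
qed (use U le in \<open>simp_all add: free_ultrafilter_def\<close>)

text \<open>All axioms are checked on representatives. The norm of a class is a limit along
  \<open>U\<close>, so the norm axioms are inherited from the coordinates, and the classes of norm 0
  are those of null sequences.\<close>

lemma normed_space_ultrapower:
  assumes U: "free_ultrafilter U"
  shows "normed_space (ultrapower E U)"
proof -
  have nt: "U \<noteq> bot" using U by (simp add: free_ultrafilter_def)
  show ?thesis
  proof (intro normed_space.intro moduleI normed_space_axioms.intro cring_scalars abelian_group_ultrapower)
    fix c :: 'k and C assume "C \<in> carrier (ultrapower E U)"
    then obtain x where x: "x \<in> carrier (linf E)" "C = ucls x" by (auto simp: carrier_ultrapower)
    have xc: "x n \<in> carrier E" for n using x by (simp add: linf_carrier_iff)
    show "c \<odot>\<^bsub>ultrapower E U\<^esub> C \<in> carrier (ultrapower E U)"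
      using x linf_smult by (simp add: carrier_ultrapower ultrapower_smult')
    show "\<one>\<^bsub>scalars\<^esub> \<odot>\<^bsub>ultrapower E U\<^esub> C = C"
      using x xc by (simp add: ultrapower_smult' scalars_def)
    show "(nrm (ultrapower E U) C = 0) = (C = \<zero>\<^bsub>ultrapower E U\<^esub>)"
      using nrm_ultrapower_tendsto[OF U x(1)] tendsto_unique[OF nt] x ucls_eq_null_seqs_iff[OF x(1)]
      by (auto simp: ultrapower_zero null_seqs_def)
    have "((\<lambda>n. nrm E (c \<odot> x n)) \<longlongrightarrow> norm c * nrm (ultrapower E U) (ucls x)) U"
      using tendsto_mult_left[OF nrm_ultrapower_tendsto[OF U x(1)], of "norm c"] xc
      by (simp add: nrm_smult)
    then show "nrm (ultrapower E U) (c \<odot>\<^bsub>ultrapower E U\<^esub> C) = norm c * nrm (ultrapower E U) C"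
      using nrm_ultrapower_tendsto[OF U linf_smult[OF x(1), of c]] tendsto_unique[OF nt] x
      by (simp add: ultrapower_smult')
  next
    fix a b :: 'k and C assume "C \<in> carrier (ultrapower E U)"
    then obtain x where x: "x \<in> carrier (linf E)" "C = ucls x" by (auto simp: carrier_ultrapower)
    have xc: "x n \<in> carrier E" for n using x by (simp add: linf_carrier_iff)
    show "(a \<oplus>\<^bsub>scalars\<^esub> b) \<odot>\<^bsub>ultrapower E U\<^esub> C
        = a \<odot>\<^bsub>ultrapower E U\<^esub> C \<oplus>\<^bsub>ultrapower E U\<^esub> b \<odot>\<^bsub>ultrapower E U\<^esub> C"
      using x xc linf_smult by (simp add: ultrapower_smult' ultrapower_add scalars_def smult_add_left)
    show "(a \<otimes>\<^bsub>scalars\<^esub> b) \<odot>\<^bsub>ultrapower E U\<^esub> C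
        = a \<odot>\<^bsub>ultrapower E U\<^esub> (b \<odot>\<^bsub>ultrapower E U\<^esub> C)"
      using x xc linf_smult by (simp add: ultrapower_smult' scalars_def smult_smult)
  next
    fix C D assume "C \<in> carrier (ultrapower E U)" "D \<in> carrier (ultrapower E U)"
    then obtain x y where x: "x \<in> carrier (linf E)" "C = ucls x" and y: "y \<in> carrier (linf E)" "D = ucls y"
      by (auto simp: carrier_ultrapower)
    have xc: "x n \<in> carrier E" "y n \<in> carrier E" for n using x y by (simp_all add: linf_carrier_iff)
    show "a \<odot>\<^bsub>ultrapower E U\<^esub> (C \<oplus>\<^bsub>ultrapower E U\<^esub> D)
        = a \<odot>\<^bsub>ultrapower E U\<^esub> C \<oplus>\<^bsub>ultrapower E U\<^esub> a \<odot>\<^bsub>ultrapower E U\<^esub> D" for a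
      using x y xc linf_smult linf_add by (simp add: ultrapower_smult' ultrapower_add smult_add_right)
    show "nrm (ultrapower E U) (C \<oplus>\<^bsub>ultrapower E U\<^esub> D)
        \<le> nrm (ultrapower E U) C + nrm (ultrapower E U) D"
      unfolding x(2) y(2) ultrapower_add[OF x(1) y(1)]
    proof (rule tendsto_le[OF nt])
      show "((\<lambda>n. nrm E (x n) + nrm E (y n)) \<longlongrightarrow>
          nrm (ultrapower E U) (ucls x) + nrm (ultrapower E U) (ucls y)) U"
        by (intro tendsto_add nrm_ultrapower_tendsto[OF U] x y)
      show "((\<lambda>n. nrm E (x n \<oplus> y n)) \<longlongrightarrow> nrm (ultrapower E U) (ucls (\<lambda>n. x n \<oplus> y n))) U"
        by (intro nrm_ultrapower_tendsto[OF U] linf_add x y)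
    qed (simp add: nrm_triangle xc)
  qed
qed

text \<open>All members of the union coincide, so this is \<open>(x\<^sub>n) \<mapsto> (T x\<^sub>n)\<close> on representatives.\<close>

definition lift_op :: "('e \<Rightarrow> 'e) \<Rightarrow> (nat \<Rightarrow> 'e) set \<Rightarrow> (nat \<Rightarrow> 'e) set" where
  "lift_op T C = (\<Union>x\<in>C. ucls (\<lambda>n. T (x n)))"

section \<open>Operators lifted to the ultrapower\<close>

lemma linf_op:
  assumes T: "T \<in> bounded_ops E E" and x: "x \<in> carrier (linf E)"
  shows "(\<lambda>n. T (x n)) \<in> carrier (linf E)"
proof -
  obtain B where B: "\<And>n. nrm E (x n) \<le> B" and xc: "\<And>n. x n \<in> carrier E"
    using x by (auto simp: linf_carrier_iff)
  have "nrm E (T (x n)) \<le> \<bar>op_norm E E T\<bar> * B" for n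
  proof -
    have "nrm E (T (x n)) \<le> op_norm E E T * nrm E (x n)"
      by (rule op_norm_bound[OF normed_space_axioms normed_space_axioms T xc])
    also have "\<dots> \<le> \<bar>op_norm E E T\<bar> * B"
      using B nrm_nonneg[OF xc] by (intro mult_mono) auto
    finally show ?thesis .
  qed
  then show ?thesis using bounded_ops_closed[OF T xc] by (auto simp: linf_carrier_iff)
qed

lemma null_seqs_op:
  assumes T: "T \<in> bounded_ops E E" and x: "x \<in> null_seqs E U"
  shows "(\<lambda>n. T (x n)) \<in> null_seqs E U"
proof -
  have xl: "x \<in> carrier (linf E)" and lim: "((\<lambda>n. nrm E (x n)) \<longlongrightarrow> 0) U"
    using x by (auto simp: null_seqs_def)
  have xc: "x n \<in> carrier E" for n using xl by (simp add: linf_carrier_iff)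
  have "norm (nrm E (T (x n))) \<le> norm (nrm E (x n)) * op_norm E E T" for n
    using op_norm_bound[OF normed_space_axioms normed_space_axioms T xc, of n]
      nrm_nonneg[OF xc, of n] nrm_nonneg[OF bounded_ops_closed[OF T xc], of n] by (simp add: mult.commute)
  then have "((\<lambda>n. nrm E (T (x n))) \<longlongrightarrow> 0) U"
    by (intro tendsto_0_le[OF lim always_eventually]) blast
  then show ?thesis using linf_op[OF T xl] by (simp add: null_seqs_def)
qed

text \<open>Two representatives differ by a null sequence, and T maps it to a null sequence by
  \<open>null_seqs_op\<close>.\<close>

lemma lift_op_ucls:
  assumes T: "T \<in> bounded_ops E E" and x: "x \<in> carrier (linf E)"
  shows "lift_op T (ucls x) = ucls (\<lambda>n. T (x n))"
proof -
  interpret S: abelian_subgroup "null_seqs E U" "linf E" by (rule null_seqs_abelian_subgroup)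
  have eq: "ucls (\<lambda>n. T (y n)) = ucls (\<lambda>n. T (x n))" if yx: "y \<in> ucls x" for y
  proof -
    obtain z where z: "z \<in> null_seqs E U" and y: "y = z \<oplus>\<^bsub>linf E\<^esub> x"
      using yx by (auto simp: a_r_coset_def')
    have zl: "z \<in> carrier (linf E)" using z by simp
    have "(\<lambda>n. T (y n)) = (\<lambda>n. T (z n)) \<oplus>\<^bsub>linf E\<^esub> (\<lambda>n. T (x n))"
      using bounded_ops_add[OF T] zl x unfolding y by (simp add: linf_simps linf_carrier_iff)
    then have "(\<lambda>n. T (y n)) \<in> ucls (\<lambda>n. T (x n))"
      using null_seqs_op[OF T z] by (auto simp: a_r_coset_def')
    then show ?thesis using S.a_repr_independence[OF _ linf_op[OF T x] S.a_subgroup] by blast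
  qed
  have "x \<in> ucls x" using x by (rule S.a_rcos_self)
  then show ?thesis unfolding lift_op_def using eq by blast
qed

lemma lift_op_bounded:
  assumes U: "free_ultrafilter U" and T: "T \<in> bounded_ops E E"
  shows "lift_op T \<in> bounded_ops (ultrapower E U) (ultrapower E U)"
proof (rule bounded_opsI)
  fix C assume "C \<in> carrier (ultrapower E U)"
  then obtain x where x: "x \<in> carrier (linf E)" "C = ucls x" by (auto simp: carrier_ultrapower)
  have xc: "x n \<in> carrier E" for n using x by (simp add: linf_carrier_iff)
  show "lift_op T C \<in> carrier (ultrapower E U)"
    using x linf_op[OF T] by (simp add: lift_op_ucls[OF T] carrier_ultrapower)
  show "lift_op T (c \<odot>\<^bsub>ultrapower E U\<^esub> C) = c \<odot>\<^bsub>ultrapower E U\<^esub> lift_op T C" for c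
    using x linf_op[OF T] linf_smult bounded_ops_smult[OF T xc]
    by (simp add: lift_op_ucls[OF T] ultrapower_smult')
  show "nrm (ultrapower E U) (lift_op T C) \<le> op_norm E E T * nrm (ultrapower E U) C"
    using nrm_ultrapower_le[OF U linf_op[OF T x(1)] x(1), of 1 "op_norm E E T"]
      op_norm_bound[OF normed_space_axioms normed_space_axioms T xc] x
    by (simp add: lift_op_ucls[OF T])
next
  fix C D assume "C \<in> carrier (ultrapower E U)" "D \<in> carrier (ultrapower E U)"
  then obtain x y where x: "x \<in> carrier (linf E)" "C = ucls x" and y: "y \<in> carrier (linf E)" "D = ucls y"
    by (auto simp: carrier_ultrapower)
  have xc: "x n \<in> carrier E" "y n \<in> carrier E" for n using x y by (simp_all add: linf_carrier_iff)
  show "lift_op T (C \<oplus>\<^bsub>ultrapower E U\<^esub> D) = lift_op T C \<oplus>\<^bsub>ultrapower E U\<^esub> lift_op T D"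
    using x y linf_op[OF T] linf_add bounded_ops_add[OF T xc(1) xc(2)]
    by (simp add: lift_op_ucls[OF T] ultrapower_add)
qed

text \<open>The bound in each coordinate passes to the limit. Conversely, constant sequences embed E
  isometrically into the ultrapower, and the lift acts on them as T.\<close>

lemma op_norm_lift_op:
  assumes U: "free_ultrafilter U" and T: "T \<in> bounded_ops E E"
  shows "op_norm (ultrapower E U) (ultrapower E U) (lift_op T) = op_norm E E T"
proof (rule antisym)
  interpret V: normed_space "ultrapower E U" by (rule normed_space_ultrapower[OF U])
  note V = V.normed_space_axioms
  note nn = op_norm_nonneg[OF normed_space_axioms normed_space_axioms T]
    op_norm_nonneg[OF V V lift_op_bounded[OF U T]]
  show "op_norm (ultrapower E U) (ultrapower E U) (lift_op T) \<le> op_norm E E T"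
  proof (rule op_norm_least[OF V _ nn(1)])
    fix C assume "C \<in> carrier (ultrapower E U)"
    then obtain x where x: "x \<in> carrier (linf E)" "C = ucls x" by (auto simp: carrier_ultrapower)
    have xc: "x n \<in> carrier E" for n using x by (simp add: linf_carrier_iff)
    show "nrm (ultrapower E U) (lift_op T C) \<le> op_norm E E T * nrm (ultrapower E U) C"
      using nrm_ultrapower_le[OF U linf_op[OF T x(1)] x(1), of 1 "op_norm E E T"]
        op_norm_bound[OF normed_space_axioms normed_space_axioms T xc] x
      by (simp add: lift_op_ucls[OF T])
  qed
  show "op_norm E E T \<le> op_norm (ultrapower E U) (ultrapower E U) (lift_op T)"
  proof (rule op_norm_least[OF normed_space_axioms _ nn(2)])
    fix x assume x: "x \<in> carrier E"
    have const: "(\<lambda>n. y) \<in> carrier (linf E)" if "y \<in> carrier E" for y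
      using that by (auto simp: linf_carrier_iff)
    have nt: "U \<noteq> bot" using U by (simp add: free_ultrafilter_def)
    have nrm_const: "nrm (ultrapower E U) (ucls (\<lambda>n. y)) = nrm E y" if "y \<in> carrier E" for y
      by (rule tendsto_unique[OF nt nrm_ultrapower_tendsto[OF U const[OF that]] tendsto_const])
    have "ucls (\<lambda>n. x) \<in> carrier (ultrapower E U)" using const[OF x] by (simp add: carrier_ultrapower)
    from op_norm_bound[OF V V lift_op_bounded[OF U T] this]
    show "nrm E (T x) \<le> op_norm (ultrapower E U) (ultrapower E U) (lift_op T) * nrm E x"
      using x by (simp add: lift_op_ucls[OF T const[OF x]] nrm_const bounded_ops_closed[OF T])
  qed
qed

section \<open>Comparison of numerical radii and of numerical indices\<close>

lemma num_radius_lift_op_le: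
  assumes U: "free_ultrafilter U" and nE: "norming E" and nU: "norming (ultrapower E U)"
    and T: "T \<in> bounded_ops E E" "op_norm E E T = 1"
  shows "num_radius (ultrapower E U) (lift_op T) \<le> num_radius E T"
proof (rule num_radius_least[OF normed_space_ultrapower[OF U] nU lift_op_bounded[OF U T(1)]])
  show "op_norm (ultrapower E U) (ultrapower E U) (lift_op T) = 1"
    using op_norm_lift_op[OF U T(1)] T(2) by simp
next
  fix c :: 'k and C assume "C \<in> carrier (ultrapower E U)"
  then obtain x where x: "x \<in> carrier (linf E)" "C = ucls x" by (auto simp: carrier_ultrapower)
  have xc: "x n \<in> carrier E" for n using x by (simp add: linf_carrier_iff)
  note Tx = linf_smult[OF linf_op[OF T(1) x(1)], of c]
  show "(1 - norm c * num_radius E T) *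
      nrm (ultrapower E U) (C \<oplus>\<^bsub>ultrapower E U\<^esub> c \<odot>\<^bsub>ultrapower E U\<^esub> lift_op T C)
      \<le> (1 + (norm c)\<^sup>2) * nrm (ultrapower E U) C"
    \<comment> \<open>The estimate for T holds in every coordinate with the same constant, so it
      passes to the limit.\<close>
    using nrm_ultrapower_le[OF U linf_add[OF x(1) Tx] x(1)
        num_radius_upper_estimate[OF normed_space_axioms nE T xc]] x Tx linf_op[OF T(1) x(1)]
    by (simp add: lift_op_ucls[OF T(1)] ultrapower_smult' ultrapower_add)
qed

text \<open>Lifting maps norm-one operators to norm-one operators with no larger radius, which
  compares the infima. If E has no norm-one operator, neither has its ultrapower, and both indices
  are \<open>Inf {}\<close>.\<close>

lemma num_index_ultrapower_le:
  assumes U: "free_ultrafilter U" and nE: "norming E" and nU: "norming (ultrapower E U)"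
  shows "num_index (ultrapower E U) \<le> num_index E"
proof -
  let ?V = "ultrapower E U"
  let ?S = "{num_radius E T | T. T \<in> bounded_ops E E \<and> op_norm E E T = 1}"
  let ?SV = "{num_radius ?V T | T. T \<in> bounded_ops ?V ?V \<and> op_norm ?V ?V T = 1}"
  note V = normed_space_ultrapower[OF U]
  show ?thesis
  proof (cases "?S = {}")
    case True
    have "?SV = {}"
    proof (rule ccontr)
      \<comment> \<open>A unit class would have a nonzero coordinate, so the identity on E would
        have norm one.\<close>
      assume "?SV \<noteq> {}"
      then obtain C where C: "C \<in> carrier ?V" "nrm ?V C = 1" using exists_unit[OF V] by blast
      then obtain x where x: "x \<in> carrier (linf E)" "C = ucls x" by (auto simp: carrier_ultrapower)
      have xc: "x n \<in> carrier E" for n using x by (simp add: linf_carrier_iff)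
      obtain n where n: "nrm E (x n) \<noteq> 0"
      proof (rule ccontr)
        assume "\<not> thesis"
        then have "nrm E (x n) = 0" for n using that by blast
        \<comment> \<open>The factors 1 and 0 express that all coordinates have norm 0, which gives
          the class norm 0.\<close>
        then show False using C nrm_ultrapower_le[OF U x(1) x(1), of 1 0] x(2) by simp
      qed
      have id: "(\<lambda>x. x) \<in> bounded_ops E E" by (rule bounded_opsI[where B = 1]) auto
      have "op_norm E E (\<lambda>x. x) = 1"
      proof (rule antisym)
        show "op_norm E E (\<lambda>x. x) \<le> 1" by (rule op_norm_least[OF normed_space_axioms]) auto
        have "0 < nrm E (x n)" using n nrm_nonneg[OF xc, of n] by simp
        then show "1 \<le> op_norm E E (\<lambda>x. x)"
          using op_norm_bound[OF normed_space_axioms normed_space_axioms id xc, of n] by simp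
      qed
      then show False using True id by blast
    qed
    then show ?thesis unfolding num_index_def True by (simp only: order_refl)
  next
    case False
    \<comment> \<open>Numerical radii of norm-one operators are nonnegative, so the infimum lies
      below each of them.\<close>
    have bd: "bdd_below ?SV"
      using num_radius_nonneg[OF V nU] by (intro bdd_belowI[of _ 0]) blast
    have "Inf ?SV \<le> num_radius E T" if T: "T \<in> bounded_ops E E" "op_norm E E T = 1" for T
    proof -
      have "num_radius ?V (lift_op T) \<in> ?SV"
        using lift_op_bounded[OF U T(1)] op_norm_lift_op[OF U T(1)] T(2) by auto
      from order_trans[OF cInf_lower[OF this bd] num_radius_lift_op_le[OF U nE nU T]] show ?thesis .
    qed
    then show ?thesis unfolding num_index_def using False by (intro cInf_greatest) auto
  qed
qed

end

end

text \<open>The conjuncts are the cases of real and of complex scalars. They differ only in the form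
  of the Hahn-Banach theorem that makes the space and its ultrapower norming.\<close>

theorem corollary3p5:
  fixes X :: "(real, 'a) nspace" and Y :: "(complex, 'b) nspace" and U :: "nat filter"
  assumes "free_ultrafilter U"
  shows "(banach_space X \<longrightarrow> num_index (ultrapower X U) \<le> num_index X) \<and>
         (banach_space Y \<longrightarrow> num_index (ultrapower Y U) \<le> num_index Y)"
proof (intro conjI impI)
  assume "banach_space X"
  then have X: "normed_space X" by (rule banach_space.axioms)
  show "num_index (ultrapower X U) \<le> num_index X"
    by (intro normed_space.num_index_ultrapower_le normed_space.normed_space_ultrapower norming_real X assms)
next
  assume "banach_space Y"
  then have Y: "normed_space Y" by (rule banach_space.axioms)
  show "num_index (ultrapower Y U) \<le> num_index Y"
    by (intro normed_space.num_index_ultrapower_le normed_space.normed_space_ultrapower norming_complex Y assms)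
qed

end
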